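(* Let $T>0$, $m\in\mathbb{R}$, $0<a<T$, $1<\alpha\le2$, $0\le\beta\le2-\alpha$ and $0<\gamma\le\alpha-1$. Assume that $$E_{\alpha,\alpha+\beta}(ma^\alpha)E_{\alpha,\alpha-1-\gamma}(ma^\alpha)\ne E_{\alpha,\alpha+\beta-1}(ma^\alpha)E_{\alpha,\alpha-\gamma}(ma^\alpha).$$ Consider the equation $$(D_{0+}^\alpha u)(t)-m\,u(t)=f(t),\qquad 0<t<T, \qquad(\mathrm{E})$$ with, for real numbers $\hat d_1,\hat d_2$, the non-local conditions $$(I_{0+}^\beta u)(t)\big|_{t=a}=\hat d_1,\qquad (D_{0+}^\gamma u)(t)\big|_{t=a}=\hat d_2. \qquad(\mathrm{N})$$ Put $\Delta=E_{\alpha,\alpha+\beta}(ma^\alpha)E_{\alpha,\alpha-1-\gamma}(ma^\alpha)-E_{\alpha,\alpha+\beta-1}(ma^\alpha)E_{\alpha,\alpha-\gamma}(ma^\alpha)$ and $$\hat E_1(m;t)=\frac{t^{\alpha-2}\big[tE_{\alpha,\alpha-1-\gamma}(ma^\alpha)E_{\alpha,\alpha}(mt^\alpha)-aE_{\alpha,\alpha-\gamma}(ma^\alpha)E_{\alpha,\alpha-1}(mt^\alpha)\big]}{a^{\alpha+\beta-1}\Delta},$$ $$\hat E_2(m;t)=\frac{t^{\alpha-2}\big[-tE_{\alpha,\alpha-1+\beta}(ma^\alpha)E_{\alpha,\alpha}(mt^\alpha)+aE_{\alpha,\alpha+\beta}(ma^\alpha)E_{\alpha,\alpha-1}(mt^\alpha)\big]}{a^{\alpha-\gamma-1}\Delta}.$$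 **(A)** Suppose $f\in C^1_{-1}[0,T]$ if $1<\alpha<2$, and $f\in C_{-1}[0,T]$ if $\alpha=2$. Then the equation (E) with the homogeneous conditions (N), $\hat d_1=\hat d_2=0$, has a unique solution $u_f\in C^2_{-1}[0,T]$, given by $$u_f(t)=-\int_0^a f(a-s)s^{\alpha-1}\big[s^\beta E_{\alpha,\alpha+\beta}(ms^\alpha)\hat E_1(m;t)+s^{-\gamma}E_{\alpha,\alpha-\gamma}(ms^\alpha)\hat E_2(m;t)\big]ds+\int_0^t f(t-s)s^{\alpha-1}E_{\alpha,\alpha}(ms^\alpha)\,ds.$$ **(B)** Let $f\equiv0$. Then the equation (E) with the non-homogeneous conditions (N) has a unique solution $u_0$, given by $$u_0(t)=\hat d_1\hat E_1(m;t)+\hat d_2\hat E_2(m;t).$$ Moreover, as functions of $t$, $$I_{0+}^\beta[\hat E_1(m;t)]\big|_{t=a}=1,\quad D_{0+}^\gamma[\hat E_1(m;t)]\big|_{t=a}=0,\quad I_{0+}^\beta[\hat E_2(m;t)]\big|_{t=a}=0,\quad D_{0+}^\gamma[\hat E_2(m;t)]\big|_{t=a}=1.$$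
   Context: For $\beta>0$ the Riemann–Liouville fractional integral is $(I_{0+}^\beta u)(t)=\frac{1}{\Gamma(\beta)}\int_0^t (t-s)^{\beta-1}u(s)\,ds$, and $I_{0+}^0$ is the identity. For $\alpha>0$ and $n=[\alpha]+1$ (with $[\cdot]$ the integer part), the Riemann–Liouville fractional derivative is $(D_{0+}^\alpha u)(t)=\big(\frac{d}{dt}\big)^n (I_{0+}^{n-\alpha}u)(t)$; for integer order it is the ordinary derivative. The two-parameter Mittag-Leffler function is $E_{\alpha,\beta}(z)=\sum_{k=0}^\infty \frac{z^k}{\Gamma(\alpha k+\beta)}$, with the convention $1/\Gamma(0)=0$ (so $E_{\alpha,0}$ is defined). A complex-valued function $f$ belongs to $C_{-1}[0,T]$ if there is a real $p>-1$ with $f(x)=x^p f_1(x)$ for some $f_1\in C[0,T]$. For $k\in\mathbb{N}_0$, $f\in C^k_{-1}[0,T]$ means $f^{(k)}\in C_{-1}[0,T]$.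
   Formalization: For 1<α<2 the claim u_f∈C²_{-1}[0,T] is false (e.g. T=2, m=0, a=1, α=3/2, β=γ=1/2, f=1) and is replaced by t^{2-α}u_f(t)∈C²_{-1}[0,T]; solutions are sought in C_{-1}[0,T], and uniqueness is proved in that larger class. *)

theory Defs
  imports "HOL-Analysis.Analysis"
begin

text \<open>Reciprocal Gamma function: \<open>rGamma\<close> vanishes at the poles of \<open>Gamma\<close>, which is the
  convention \<open>1 / \<Gamma>(0) = 0\<close>.\<close>

definition mittag_leffler ::
    "real \<Rightarrow> real \<Rightarrow> 'a::{real_normed_field,banach} \<Rightarrow> 'a" where
  "mittag_leffler \<alpha> \<beta> z = (\<Sum>k. rGamma (\<alpha> * real k + \<beta>) *\<^sub>R z ^ k)"

text \<open>\<open>nth_vderiv\<close> is meaningful only together with \<open>times_differentiable_on\<close>, since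
  \<open>vector_derivative\<close> is arbitrary where the derivative does not exist. For
  \<open>S = {0<..T}\<close> the derivative at \<open>T\<close> is one-sided.\<close>

primrec nth_vderiv ::
    "real set \<Rightarrow> nat \<Rightarrow> (real \<Rightarrow> 'a::real_normed_vector) \<Rightarrow> real \<Rightarrow> 'a" where
  "nth_vderiv S 0 f = f"
| "nth_vderiv S (Suc k) f = (\<lambda>x. vector_derivative (nth_vderiv S k f) (at x within S))"

definition times_differentiable_on ::
    "nat \<Rightarrow> (real \<Rightarrow> 'a::real_normed_vector) \<Rightarrow> real set \<Rightarrow> bool" where
  "times_differentiable_on n f S \<longleftrightarrow> (\<forall>k<n. nth_vderiv S k f differentiable_on S)"

definition rl_integral ::
    "real \<Rightarrow> (real \<Rightarrow> 'a::{banach,second_countable_topology}) \<Rightarrow> real \<Rightarrow> 'a" where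
  "rl_integral \<beta> u t =
     (if \<beta> = 0 then u t
      else (1 / Gamma \<beta>) *\<^sub>R (LBINT s:{0..t}. (t - s) powr (\<beta> - 1) *\<^sub>R u s))"

text \<open>The number of derivatives taken: \<open>[\<alpha>] + 1\<close>, except that for integer \<open>\<alpha>\<close> it is \<open>\<alpha>\<close>,
  so that \<open>rl_deriv \<alpha>\<close> is then the ordinary derivative, \<open>rl_integral 0\<close> being the identity.\<close>

definition rl_order :: "real \<Rightarrow> nat" where
  "rl_order \<alpha> = (if \<alpha> \<in> \<int> then nat \<lfloor>\<alpha>\<rfloor> else nat \<lfloor>\<alpha>\<rfloor> + 1)"

text \<open>Used on open \<open>S \<subseteq> {0<..}\<close> only; there the derivatives within \<open>S\<close> are the two-sided
  ones, so \<open>rl_deriv\<close> gives the correct values on \<open>S\<close> whenever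
  \<open>rl_differentiable_on \<alpha> u S\<close>.\<close>

definition rl_differentiable_on ::
    "real \<Rightarrow> (real \<Rightarrow> 'a::{banach,second_countable_topology}) \<Rightarrow> real set \<Rightarrow> bool" where
  "rl_differentiable_on \<alpha> u S \<longleftrightarrow>
     times_differentiable_on (rl_order \<alpha>) (rl_integral (real (rl_order \<alpha>) - \<alpha>) u) S"

definition rl_deriv ::
    "real \<Rightarrow> (real \<Rightarrow> 'a::{banach,second_countable_topology}) \<Rightarrow> real \<Rightarrow> 'a" where
  "rl_deriv \<alpha> u = nth_vderiv UNIV (rl_order \<alpha>) (rl_integral (real (rl_order \<alpha>) - \<alpha>) u)"

text \<open>The value of \<open>f\<close> at \<open>0\<close> is not constrained: \<open>x powr p\<close> with \<open>p < 0\<close> is singular there.\<close>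

definition C_minus_one :: "real \<Rightarrow> (real \<Rightarrow> complex) \<Rightarrow> bool" where
  "C_minus_one T f \<longleftrightarrow>
     (\<exists>p>-1. \<exists>f1. continuous_on {0..T} f1 \<and> (\<forall>x\<in>{0<..T}. f x = x powr p *\<^sub>R f1 x))"

definition C_minus_one_k :: "nat \<Rightarrow> real \<Rightarrow> (real \<Rightarrow> complex) \<Rightarrow> bool" where
  "C_minus_one_k k T f \<longleftrightarrow>
     times_differentiable_on k f {0<..T} \<and> C_minus_one T (nth_vderiv {0<..T} k f)"

text \<open>Where a solution \<open>u\<close> is claimed to be in \<open>C\<^sup>2\<^sub>-\<^sub>1[0,T]\<close>, the statement puts
  \<open>t powr (2 - \<alpha>) *\<^sub>R u t\<close> there instead; for \<open>\<alpha> = 2\<close> this is the same on \<open>{0<..T}\<close>. For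
  \<open>\<alpha> < 2\<close> the unweighted claim is false: with \<open>T = 2\<close>, \<open>m = 0\<close>, \<open>a = 1\<close>, \<open>\<alpha> = 3/2\<close>,
  \<open>\<beta> = \<gamma> = 1/2\<close> and \<open>f = 1\<close> (so \<open>\<Delta> = -1\<close>) the only solution is
  \<open>- t powr (1/2) / Gamma (3/2) + t powr (-1/2) / (2 * Gamma (1/2)) + t powr (3/2) / Gamma (5/2)\<close>,
  whose second derivative is of order \<open>t powr (-5/2)\<close> at \<open>0\<close>. Uniqueness is asserted among all
  solutions in \<open>C\<^sub>-\<^sub>1[0,T]\<close>, which contains both \<open>C\<^sup>2\<^sub>-\<^sub>1[0,T]\<close> and the weighted class.

  \<open>C_minus_one T u\<close> makes all fractional integrals of \<open>u\<close> converge absolutely; the order-\<open>\<gamma>\<close>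
  derivative is required to exist near \<open>a\<close>, that is, on all of \<open>{0<..<T}\<close>.\<close>

definition nonlocal_solution ::
    "real \<Rightarrow> real \<Rightarrow> real \<Rightarrow> real \<Rightarrow> real \<Rightarrow> real \<Rightarrow> (real \<Rightarrow> complex) \<Rightarrow> real \<Rightarrow> real
       \<Rightarrow> (real \<Rightarrow> complex) \<Rightarrow> bool" where
  "nonlocal_solution T m a \<alpha> \<beta> \<gamma> f d1 d2 u \<longleftrightarrow>
     C_minus_one T u \<and>
     rl_differentiable_on \<alpha> u {0<..<T} \<and>
     (\<forall>t\<in>{0<..<T}. rl_deriv \<alpha> u t - of_real m * u t = f t) \<and>
     rl_integral \<beta> u a = of_real d1 \<and>
     rl_differentiable_on \<gamma> u {0<..<T} \<and> rl_deriv \<gamma> u a = of_real d2"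

definition Delta :: "real \<Rightarrow> real \<Rightarrow> real \<Rightarrow> real \<Rightarrow> real \<Rightarrow> real" where
  "Delta m a \<alpha> \<beta> \<gamma> =
     mittag_leffler \<alpha> (\<alpha> + \<beta>) (m * a powr \<alpha>) * mittag_leffler \<alpha> (\<alpha> - 1 - \<gamma>) (m * a powr \<alpha>)
     - mittag_leffler \<alpha> (\<alpha> + \<beta> - 1) (m * a powr \<alpha>) * mittag_leffler \<alpha> (\<alpha> - \<gamma>) (m * a powr \<alpha>)"

definition E1_hat :: "real \<Rightarrow> real \<Rightarrow> real \<Rightarrow> real \<Rightarrow> real \<Rightarrow> real \<Rightarrow> real" where
  "E1_hat m a \<alpha> \<beta> \<gamma> t =
     t powr (\<alpha> - 2) *
       (t * mittag_leffler \<alpha> (\<alpha> - 1 - \<gamma>) (m * a powr \<alpha>) * mittag_leffler \<alpha> \<alpha> (m * t powr \<alpha>)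
        - a * mittag_leffler \<alpha> (\<alpha> - \<gamma>) (m * a powr \<alpha>) * mittag_leffler \<alpha> (\<alpha> - 1) (m * t powr \<alpha>))
     / (a powr (\<alpha> + \<beta> - 1) * Delta m a \<alpha> \<beta> \<gamma>)"

definition E2_hat :: "real \<Rightarrow> real \<Rightarrow> real \<Rightarrow> real \<Rightarrow> real \<Rightarrow> real \<Rightarrow> real" where
  "E2_hat m a \<alpha> \<beta> \<gamma> t =
     t powr (\<alpha> - 2) *
       (- t * mittag_leffler \<alpha> (\<alpha> - 1 + \<beta>) (m * a powr \<alpha>) * mittag_leffler \<alpha> \<alpha> (m * t powr \<alpha>)
        + a * mittag_leffler \<alpha> (\<alpha> + \<beta>) (m * a powr \<alpha>) * mittag_leffler \<alpha> (\<alpha> - 1) (m * t powr \<alpha>))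
     / (a powr (\<alpha> - \<gamma> - 1) * Delta m a \<alpha> \<beta> \<gamma>)"

definition u_f ::
    "real \<Rightarrow> real \<Rightarrow> real \<Rightarrow> real \<Rightarrow> real \<Rightarrow> (real \<Rightarrow> complex) \<Rightarrow> real \<Rightarrow> complex" where
  "u_f m a \<alpha> \<beta> \<gamma> f t =
     - (LBINT s:{0..a}.
          (s powr (\<alpha> - 1) *
             (s powr \<beta> * mittag_leffler \<alpha> (\<alpha> + \<beta>) (m * s powr \<alpha>) * E1_hat m a \<alpha> \<beta> \<gamma> t
              + s powr (-\<gamma>) * mittag_leffler \<alpha> (\<alpha> - \<gamma>) (m * s powr \<alpha>) * E2_hat m a \<alpha> \<beta> \<gamma> t))
          *\<^sub>R f (a - s))
     + (LBINT s:{0..t}. (s powr (\<alpha> - 1) * mittag_leffler \<alpha> \<alpha> (m * s powr \<alpha>)) *\<^sub>R f (t - s))"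

definition u_0 ::
    "real \<Rightarrow> real \<Rightarrow> real \<Rightarrow> real \<Rightarrow> real \<Rightarrow> real \<Rightarrow> real \<Rightarrow> real \<Rightarrow> complex" where
  "u_0 m a \<alpha> \<beta> \<gamma> d1 d2 t =
     of_real (d1 * E1_hat m a \<alpha> \<beta> \<gamma> t + d2 * E2_hat m a \<alpha> \<beta> \<gamma> t)"

end

theory Submission
  imports Defs
begin

text \<open>The functions \<open>e\<^sub>\<delta>(t) = t\<^bsup>\<delta>-1\<^esup> E\<^bsub>\<alpha>,\<delta>\<^esub>(m t\<^bsup>\<alpha>\<^esup>)\<close> satisfy \<open>I\<^bsup>\<beta>\<^esup> e\<^sub>\<delta> = e\<^bsub>\<beta>+\<delta>\<^esub>\<close>,
  \<open>e\<^sub>\<delta>' = e\<^bsub>\<delta>-1\<^esub>\<close> and \<open>e\<^sub>\<delta> = t\<^bsup>\<delta>-1\<^esup> / \<Gamma>(\<delta>) + m e\<^bsub>\<delta>+\<alpha>\<^esub>\<close>. Together with the associativity of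
  convolution on \<open>(0,t)\<close> this shows that \<open>c\<^sub>0 e\<^bsub>\<alpha>-1\<^esub> + c\<^sub>1 e\<^sub>\<alpha> + e\<^sub>\<alpha> * f\<close> solves (E), and that taking
  \<open>I\<^bsup>\<beta>\<^esup>\<close> or \<open>D\<^bsup>\<gamma>\<^esup>\<close> only shifts the indices by \<open>\<beta>\<close> or \<open>-\<gamma>\<close>. Conversely every solution has this form:
  if \<open>v = I\<^bsup>2-\<alpha>\<^esup> u = c\<^sub>0 + c\<^sub>1 t + I\<^sup>2 (f + m u)\<close>, then in \<open>e\<^sub>\<alpha> * v\<close> all terms with \<open>u\<close> except \<open>I\<^sup>2 u\<close>
  cancel, so no iteration of the Volterra equation is needed. The conditions (N) are then a linear
  system for \<open>c\<^sub>0, c\<^sub>1\<close> whose determinant is a nonzero multiple of \<open>\<Delta>\<close>.\<close>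

section \<open>Weighted continuous functions and their convolutions\<close>

text \<open>No derivative is taken under the integral sign, because the kernels may be singular at
  0. A convolution with index above 1 is recognised as the ordinary primitive of the convolution
  with index lower by 1, and the fundamental theorem applies on \<open>{0<..T}\<close>. Index 1 is
  where this stops: the shift identity splits off the primitive of f, so that f itself appears after
  differentiation, as (E) demands.

  The cancellation comes from computing e_\<alpha> * v twice. From v = I^(2-\<alpha>) u it equals
  e_2 * u = I^2 u + m e_(\<alpha>+2) * u. From the twice integrated equation it is e_(\<alpha>+1) c0
  + e_(\<alpha>+2) c1 + e_(\<alpha>+2) * f + m e_(\<alpha>+2) * u. The last terms agree, which
  leaves an explicit formula for I^2 u, and two derivatives recover u.

  \<open>weighted_cont\<close> keeps the exponent visible that \<open>C_minus_one\<close> hides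
  under an existential: exponents p and q become p + q + 1 under convolution, and integrability at 0
  is decided by comparing them with -1. The codomain is general, so that real kernels and complex
  data share the lemmas.\<close>

definition weighted_cont :: "real \<Rightarrow> real \<Rightarrow> (real \<Rightarrow> 'a::real_normed_vector) \<Rightarrow> bool" where
  "weighted_cont p T f \<longleftrightarrow>
     (\<exists>g. continuous_on {0..T} g \<and> (\<forall>x\<in>{0<..T}. f x = x powr p *\<^sub>R g x))"

lemma C_minus_one_iff: "C_minus_one T f \<longleftrightarrow> (\<exists>p>-1. weighted_cont p T f)"
  by (simp add: C_minus_one_def weighted_cont_def)

lemma weighted_contI:
  assumes "continuous_on {0..T} g" "\<And>x. 0 < x \<Longrightarrow> x \<le> T \<Longrightarrow> f x = x powr p *\<^sub>R g x"
  shows "weighted_cont p T f"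
  using assms unfolding weighted_cont_def by auto

lemma weighted_contE:
  assumes "weighted_cont p T f"
  obtains g where "continuous_on {0..T} g" "\<And>x. 0 < x \<Longrightarrow> x \<le> T \<Longrightarrow> f x = x powr p *\<^sub>R g x"
  using assms unfolding weighted_cont_def by auto

lemma weighted_cont_cong:
  assumes "\<And>x. 0 < x \<Longrightarrow> x \<le> T \<Longrightarrow> f x = g x"
  shows "weighted_cont p T f \<longleftrightarrow> weighted_cont p T g"
  using assms unfolding weighted_cont_def by auto

lemma weighted_cont_powr_scaleR:
  assumes "weighted_cont p T f"
  shows "weighted_cont (q + p) T (\<lambda>x. x powr q *\<^sub>R f x)"
proof -
  from assms obtain g where g: "continuous_on {0..T} g"
      "\<And>x. 0 < x \<Longrightarrow> x \<le> T \<Longrightarrow> f x = x powr p *\<^sub>R g x"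
    by (rule weighted_contE) blast
  show ?thesis
    by (rule weighted_contI[OF g(1)]) (simp add: g(2) powr_add)
qed

lemma weighted_cont_mono:
  assumes "weighted_cont p T f" "q \<le> p"
  shows "weighted_cont q T f"
\<comment> \<open>In HOL \<open>0 powr 0 = 0\<close>, so the factor \<open>x powr (p - q)\<close> is
  continuous at 0 only for q < p.\<close>
proof (cases "q = p")
  case False
  from assms(1) obtain g where g: "continuous_on {0..T} g"
      "\<And>x. 0 < x \<Longrightarrow> x \<le> T \<Longrightarrow> f x = x powr p *\<^sub>R g x"
    by (rule weighted_contE) blast
  show ?thesis
  proof (rule weighted_contI)
    show "continuous_on {0..T} (\<lambda>x. x powr (p - q) *\<^sub>R g x)"
      using False assms(2) by (intro continuous_intros continuous_on_powr' g) auto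
  next
    fix x assume "0 < x" "x \<le> T"
    then show "f x = x powr q *\<^sub>R x powr (p - q) *\<^sub>R g x"
      by (simp add: g(2) flip: powr_add)
  qed
qed (use assms in simp)

lemma weighted_cont_add:
  assumes "weighted_cont p T f" "weighted_cont p T g"
  shows "weighted_cont p T (\<lambda>x. f x + g x)"
proof -
  obtain f1 where f1: "continuous_on {0..T} f1" "\<And>x. 0 < x \<Longrightarrow> x \<le> T \<Longrightarrow> f x = x powr p *\<^sub>R f1 x"
    using assms(1) by (rule weighted_contE) blast
  obtain g1 where g1: "continuous_on {0..T} g1" "\<And>x. 0 < x \<Longrightarrow> x \<le> T \<Longrightarrow> g x = x powr p *\<^sub>R g1 x"
    using assms(2) by (rule weighted_contE) blast
  show ?thesis
    by (rule weighted_contI[of T "\<lambda>x. f1 x + g1 x"])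
       (auto simp: f1(2) g1(2) scaleR_add_right intro!: continuous_intros f1 g1)
qed

lemma weighted_cont_scaleR:
  assumes "weighted_cont p T f"
  shows "weighted_cont p T (\<lambda>x. c *\<^sub>R f x)"
proof -
  obtain f1 where f1: "continuous_on {0..T} f1" "\<And>x. 0 < x \<Longrightarrow> x \<le> T \<Longrightarrow> f x = x powr p *\<^sub>R f1 x"
    using assms(1) by (rule weighted_contE) blast
  show ?thesis
    by (rule weighted_contI[of T "\<lambda>x. c *\<^sub>R f1 x"])
       (auto simp: f1(2) intro!: continuous_intros f1)
qed

lemma weighted_cont_scaleR_left:
  assumes "weighted_cont p T f"
  shows "weighted_cont p T (\<lambda>x. f x *\<^sub>R c)"
proof -
  obtain f1 where f1: "continuous_on {0..T} f1" "\<And>x. 0 < x \<Longrightarrow> x \<le> T \<Longrightarrow> f x = x powr p *\<^sub>R f1 x"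
    using assms(1) by (rule weighted_contE) blast
  show ?thesis
    by (rule weighted_contI[of T "\<lambda>x. f1 x *\<^sub>R c"])
       (auto simp: f1(2) intro!: continuous_intros f1)
qed

lemma weighted_cont_const: "weighted_cont 0 T (\<lambda>_. c)"
  by (rule weighted_contI[of T "\<lambda>_. c"]) (auto intro!: continuous_intros)

lemma weighted_cont_zero: "weighted_cont p T (\<lambda>_. 0)"
  by (rule weighted_contI[of T "\<lambda>_. 0"]) (auto intro!: continuous_intros)

lemma weighted_cont_norm:
  assumes "weighted_cont p T f"
  shows "weighted_cont p T (\<lambda>x. norm (f x))"
proof -
  obtain f1 where f1: "continuous_on {0..T} f1" "\<And>x. 0 < x \<Longrightarrow> x \<le> T \<Longrightarrow> f x = x powr p *\<^sub>R f1 x"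
    using assms(1) by (rule weighted_contE) blast
  show ?thesis
    by (rule weighted_contI[of T "\<lambda>x. norm (f1 x)"])
       (auto simp: f1(2) intro!: continuous_intros f1)
qed

lemma weighted_cont_imp_continuous_on:
  assumes "weighted_cont p T f"
  shows "continuous_on {0<..T} f"
proof -
  obtain f1 where f1: "continuous_on {0..T} f1" "\<And>x. 0 < x \<Longrightarrow> x \<le> T \<Longrightarrow> f x = x powr p *\<^sub>R f1 x"
    using assms(1) by (rule weighted_contE) blast
  have "continuous_on {0<..T} (\<lambda>x. x powr p *\<^sub>R f1 x)"
    by (intro continuous_intros continuous_on_subset[OF f1(1)]) auto
  then show ?thesis
    by (rule continuous_on_eq) (auto simp: f1)
qed

section \<open>Beta integrals and convolution on (0,t)\<close>

text \<open>The integrand is nonnegative, so the gauge integral defining Beta passes through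
  \<open>nn_integral\<close> to the Bochner integral. This function dominates every rescaled
  convolution integrand below.\<close>

lemma has_bochner_integral_beta:
  fixes p q :: real
  assumes "p > -1" "q > -1"
  shows "has_bochner_integral lborel
           (\<lambda>x. indicator {0<..<1} x *\<^sub>R ((1 - x) powr p * x powr q)) (Beta (q + 1) (p + 1))"
proof -
  let ?f = "\<lambda>x::real. indicator {0<..<1} x *\<^sub>R ((1 - x) powr p * x powr q)"
  have "((\<lambda>x. (1 - x) powr p * x powr q) has_integral Beta (q + 1) (p + 1)) {0<..<1}"
    using has_integral_Beta_real[of "q + 1" "p + 1"] assms
    by (simp add: has_integral_Icc_iff_Ioo mult.commute)
  then have "((\<lambda>x. if x \<in> {0<..<1} then (1 - x) powr p * x powr q else 0)
      has_integral Beta (q + 1) (p + 1)) UNIV"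
    by (simp only: has_integral_restrict_UNIV)
  then have I: "(?f has_integral Beta (q + 1) (p + 1)) UNIV"
    by (rule has_integral_eq[rotated]) (auto simp: indicator_def)
  have "(\<integral>\<^sup>+ x. ennreal (?f x) \<partial>lborel) = ennreal (Beta (q + 1) (p + 1))"
    by (rule nn_integral_has_integral_lborel[OF _ _ I]) (auto simp: indicator_def)
  moreover have "0 \<le> Beta (q + 1) (p + 1)"
    using assms by (intro has_integral_nonneg[OF I]) (auto simp: indicator_def)
  ultimately show ?thesis
    by (intro has_bochner_integral_nn_integral) (auto simp: indicator_def)
qed

text \<open>Substituting s = t x fixes the domain of integration, so that t occurs in the integrand
  only and dominated convergence can be used in t.\<close>

lemma lborel_set_integral_scale:
  fixes F :: "real \<Rightarrow> 'a::{banach,second_countable_topology}"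
  assumes "t > 0"
  shows "(LBINT s:{0<..<t}. F s) = t *\<^sub>R (LBINT x:{0<..<1}. F (t * x))"
    and "set_integrable lborel {0<..<t} F \<longleftrightarrow> set_integrable lborel {0<..<1} (\<lambda>x. F (t * x))"
proof -
  have eq: "indicator {0<..<t} (0 + t * x) *\<^sub>R F (0 + t * x) = indicator {0<..<1} x *\<^sub>R F (t * x)" for x
    using assms by (auto simp: indicator_def zero_less_mult_iff)
  show "(LBINT s:{0<..<t}. F s) = t *\<^sub>R (LBINT x:{0<..<1}. F (t * x))"
    using lborel_integral_real_affine[of t "\<lambda>s. indicator {0<..<t} s *\<^sub>R F s" 0] assms
    unfolding set_lebesgue_integral_def eq by simp
  show "set_integrable lborel {0<..<t} F \<longleftrightarrow> set_integrable lborel {0<..<1} (\<lambda>x. F (t * x))"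
    unfolding set_integrable_def
    using lborel_integrable_real_affine_iff[of t "\<lambda>s. indicator {0<..<t} s *\<^sub>R F s" 0] assms
    unfolding eq by simp
qed

text \<open>The interval is open because weighted functions are unconstrained at 0; neither f nor
  the kernel is evaluated there. The kernel is real and f vector-valued, hence commutativity is
  stated for real functions only.\<close>

definition conv :: "(real \<Rightarrow> real) \<Rightarrow> (real \<Rightarrow> 'a::{banach,second_countable_topology}) \<Rightarrow> real \<Rightarrow> 'a"
  where "conv k f t = (LBINT s:{0<..<t}. k (t - s) *\<^sub>R f s)"

lemma conv_cong:
  assumes "\<And>s. 0 < s \<Longrightarrow> s < t \<Longrightarrow> k s = k' s" "\<And>s. 0 < s \<Longrightarrow> s < t \<Longrightarrow> f s = f' s"
  shows "conv k f t = conv k' f' t"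
  unfolding conv_def by (rule set_lebesgue_integral_cong) (use assms in auto)

lemma conv_commute: "conv k f t = (LBINT s:{0<..<t}. k s *\<^sub>R f (t - s))"
proof -
  have eq: "indicator {0<..<t} (t + (-1) * x) *\<^sub>R k (t - (t + (-1) * x)) *\<^sub>R f (t + (-1) * x) =
        indicator {0<..<t} x *\<^sub>R k x *\<^sub>R f (t - x)" for x
    by (auto simp: indicator_def)
  show ?thesis
    using lborel_integral_real_affine[of "-1" "\<lambda>s. indicator {0<..<t} s *\<^sub>R k (t - s) *\<^sub>R f s" t]
    unfolding conv_def set_lebesgue_integral_def eq by simp
qed

lemma conv_commute_real: "conv k f t = conv f k t" for f :: "real \<Rightarrow> real"
  by (subst conv_commute) (simp add: conv_def mult.commute)

lemma set_integral_dominated_beta: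
  fixes F :: "real \<Rightarrow> 'a::{banach,second_countable_topology}"
  assumes "p > -1" "q > -1" "continuous_on {0<..<1} F"
    "\<And>x. x \<in> {0<..<1} \<Longrightarrow> norm (F x) \<le> M * ((1 - x) powr p * x powr q)"
  shows "set_integrable lborel {0<..<1} F"
proof -
  have 1: "set_integrable lborel {0<..<1} (\<lambda>x. M * ((1 - x) powr p * x powr q))"
    using has_bochner_integral_beta[OF assms(1,2)]
    by (intro set_integrable_mult_right) (auto simp: set_integrable_def has_bochner_integral_iff)
  show ?thesis
    unfolding set_integrable_def
  proof (rule Bochner_Integration.integrable_bound[OF 1[unfolded set_integrable_def]])
    show "(\<lambda>x. indicator {0<..<1} x *\<^sub>R F x) \<in> borel_measurable lborel"
      using borel_measurable_continuous_on_indicator[OF _ assms(3)] by simp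
    show "AE x in lborel. norm (indicat_real {0<..<1} x *\<^sub>R F x)
        \<le> norm (indicat_real {0<..<1} x *\<^sub>R (M * ((1 - x) powr p * x powr q)))"
      using assms(4) by (intro AE_I2) (auto simp: indicator_def intro: order.trans[OF _ abs_ge_self])
  qed
qed

lemma continuous_on_Icc_bound:
  assumes "continuous_on {0..T} (g :: real \<Rightarrow> 'a::real_normed_vector)"
  obtains M where "M \<ge> 0" "\<And>x. x \<in> {0..T} \<Longrightarrow> norm (g x) \<le> M"
proof -
  have "bounded (g ` {0..T})"
    by (intro compact_imp_bounded compact_continuous_image assms) auto
  then obtain M where "\<forall>x\<in>{0..T}. norm (g x) \<le> M"
    unfolding bounded_iff by blast
  then show thesis
    using that[of "max M 0"] by (auto simp: max.coboundedI1)
qed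

lemma scaled_arguments: "x \<in> {0<..<1} \<Longrightarrow> 0 \<le> t \<Longrightarrow> t \<le> T \<Longrightarrow> t * x \<in> {0..T}"
  "x \<in> {0<..<1} \<Longrightarrow> 0 \<le> t \<Longrightarrow> t \<le> T \<Longrightarrow> t * (1 - x) \<in> {0..T}" for x t T :: real
  using mult_left_le[of x t] mult_left_le[of "1 - x" t] by auto

text \<open>Continuous factors on \<open>{0..T}\<close> are bounded, so a multiple of the Beta
  density dominates the integrand uniformly in t. Dominated convergence then gives continuity on the
  closed interval; the point t = 0 is needed for the continuous factor demanded by
  \<open>weighted_cont\<close>.\<close>

lemma beta_weighted_integral:
  fixes k1 :: "real \<Rightarrow> real" and f1 :: "real \<Rightarrow> 'a::{banach,second_countable_topology}"
  assumes pq: "p > -1" "q > -1" and k1: "continuous_on {0..T} k1" and f1: "continuous_on {0..T} f1"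
  shows "0 \<le> t \<Longrightarrow> t \<le> T \<Longrightarrow> set_integrable lborel {0<..<1}
            (\<lambda>x. ((1 - x) powr p * x powr q) *\<^sub>R k1 (t * (1 - x)) *\<^sub>R f1 (t * x))" (is "_ \<Longrightarrow> _ \<Longrightarrow> ?A")
    and "continuous_on {0..T} (\<lambda>t. LBINT x:{0<..<1}.
            ((1 - x) powr p * x powr q) *\<^sub>R k1 (t * (1 - x)) *\<^sub>R f1 (t * x))" (is ?B)
proof -
  obtain M where M: "M \<ge> 0" "\<And>x. x \<in> {0..T} \<Longrightarrow> norm (k1 x) \<le> M"
    using k1 by (rule continuous_on_Icc_bound) blast
  obtain N where N: "N \<ge> 0" "\<And>x. x \<in> {0..T} \<Longrightarrow> norm (f1 x) \<le> N"
    using f1 by (rule continuous_on_Icc_bound) blast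
  let ?F = "\<lambda>t x. ((1 - x) powr p * x powr q) *\<^sub>R k1 (t * (1 - x)) *\<^sub>R f1 (t * x)"
  have cont: "continuous_on {0<..<1} (?F t)" if "0 \<le> t" "t \<le> T" for t
    using that
    by (intro continuous_intros continuous_on_compose2[OF k1] continuous_on_compose2[OF f1])
       (use scaled_arguments in auto)
  have bound: "norm (?F t x) \<le> (M * N) * ((1 - x) powr p * x powr q)"
    if "0 \<le> t" "t \<le> T" "x \<in> {0<..<1}" for t x
  proof -
    have "norm (k1 (t * (1 - x))) * norm (f1 (t * x)) \<le> M * N"
      by (intro mult_mono M N scaled_arguments that) auto
    then show ?thesis
      using mult_right_mono[OF \<open>norm (k1 (t * (1 - x))) * norm (f1 (t * x)) \<le> M * N\<close>, of "(1 - x) powr p * x powr q"] by (simp add: abs_mult mult_ac)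
  qed
  show ?A if "0 \<le> t" "t \<le> T"
    using set_integral_dominated_beta[OF pq cont[OF that] bound[OF that]] by simp
  have I: "integrable lborel (\<lambda>x. indicator {0<..<1} x *\<^sub>R ((1 - x) powr p * x powr q))"
    using has_bochner_integral_beta[OF pq] by (simp add: has_bochner_integral_iff)
  show ?B
  proof (rule continuous_on_sequentiallyI)
    fix u t assume u: "\<forall>n. u n \<in> {0..T}" and t: "t \<in> {0..T}" and ut: "u \<longlonglongrightarrow> t"
    show "(\<lambda>n. LBINT x:{0<..<1}. ?F (u n) x) \<longlonglongrightarrow> (LBINT x:{0<..<1}. ?F t x)"
      unfolding set_lebesgue_integral_def
    proof (rule integral_dominated_convergence)
      show "integrable lborel (\<lambda>x. (M * N) * (indicator {0<..<1} x *\<^sub>R ((1 - x) powr p * x powr q)))"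
        by (intro integrable_mult_right I)
      show "(\<lambda>x. indicator {0<..<1} x *\<^sub>R ?F t x) \<in> borel_measurable lborel"
        using borel_measurable_continuous_on_indicator[OF _ cont[of t]] t by simp
      show "(\<lambda>x. indicator {0<..<1} x *\<^sub>R ?F (u n) x) \<in> borel_measurable lborel" for n
        using borel_measurable_continuous_on_indicator[OF _ cont[of "u n"]] u by simp
      show "AE x in lborel. norm (indicator {0<..<1} x *\<^sub>R ?F (u n) x) \<le>
          (M * N) * (indicator {0<..<1} x *\<^sub>R ((1 - x) powr p * x powr q))" for n
        using bound[of "u n"] u by (intro AE_I2) (auto simp: indicator_def simp del: norm_scaleR)
      show "AE x in lborel. (\<lambda>n. indicator {0<..<1} x *\<^sub>R ?F (u n) x)
          \<longlonglongrightarrow> indicator {0<..<1} x *\<^sub>R ?F t x"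
      proof (rule AE_I2)
        fix x :: real
        show "(\<lambda>n. indicator {0<..<1} x *\<^sub>R ?F (u n) x) \<longlonglongrightarrow> indicator {0<..<1} x *\<^sub>R ?F t x"
        proof (cases "x \<in> {0<..<1}")
          case True
          have "(\<lambda>n. k1 (u n * (1 - x))) \<longlonglongrightarrow> k1 (t * (1 - x))"
            by (rule continuous_on_tendsto_compose[OF k1])
               (use scaled_arguments True u t in \<open>auto intro!: tendsto_intros ut always_eventually\<close>)
          moreover have "(\<lambda>n. f1 (u n * x)) \<longlonglongrightarrow> f1 (t * x)"
            by (rule continuous_on_tendsto_compose[OF f1])
               (use scaled_arguments True u t in \<open>auto intro!: tendsto_intros ut always_eventually\<close>)
          ultimately show ?thesis
            by (intro tendsto_intros)
        qed simp
      qed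
    qed
  qed
qed

lemma weighted_product_scaled:
  fixes f1 :: "real \<Rightarrow> 'a::real_normed_vector"
  assumes "\<And>x. 0 < x \<Longrightarrow> x \<le> T \<Longrightarrow> k x = x powr p *\<^sub>R k1 x"
    "\<And>x. 0 < x \<Longrightarrow> x \<le> T \<Longrightarrow> f x = x powr q *\<^sub>R f1 x"
    and "0 < t" "t \<le> T" "x \<in> {0<..<1}"
  shows "k (t - t * x) *\<^sub>R f (t * x) =
     t powr (p + q) *\<^sub>R ((1 - x) powr p * x powr q) *\<^sub>R k1 (t * (1 - x)) *\<^sub>R f1 (t * x)"
proof -
  have *: "t - t * x = t * (1 - x)" by (simp add: algebra_simps)
  have "0 < t * x" "0 < t * (1 - x)"
    using assms by auto
  moreover have "t * x \<le> T" "t * (1 - x) \<le> T"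
    using scaled_arguments[of x t T] assms by auto
  ultimately show ?thesis
    unfolding * using assms
    by (simp add: powr_mult powr_add mult_ac)
qed

lemma conv_integrable:
  fixes f :: "real \<Rightarrow> 'a::{banach,second_countable_topology}"
  assumes "weighted_cont p T k" "weighted_cont q T f" "p > -1" "q > -1" "t \<le> T"
  shows "set_integrable lborel {0<..<t} (\<lambda>s. k (t - s) *\<^sub>R f s)"
proof (cases "t > 0")
  case True
  obtain k1 where k1: "continuous_on {0..T} k1" "\<And>x. 0 < x \<Longrightarrow> x \<le> T \<Longrightarrow> k x = x powr p *\<^sub>R k1 x"
    using assms(1) by (rule weighted_contE) blast
  obtain f1 where f1: "continuous_on {0..T} f1" "\<And>x. 0 < x \<Longrightarrow> x \<le> T \<Longrightarrow> f x = x powr q *\<^sub>R f1 x"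
    using assms(2) by (rule weighted_contE) blast
  have "set_integrable lborel {0<..<1} (\<lambda>x. t powr (p + q) *\<^sub>R ((1 - x) powr p * x powr q) *\<^sub>R
          k1 (t * (1 - x)) *\<^sub>R f1 (t * x))"
    by (intro set_integrable_scaleR_right beta_weighted_integral(1)[OF assms(3,4) k1(1) f1(1)])
       (use True assms in auto)
  then show ?thesis
    unfolding lborel_set_integral_scale(2)[OF True]
    by (rule set_integrable_cong[THEN iffD1, rotated -1])
       (use weighted_product_scaled[OF k1(2) f1(2) True assms(5)] in auto)
next
  case False
  then show ?thesis by (simp add: set_integrable_def)
qed

text \<open>After s = t x the weights contribute t to the power p + q and the substitution one
  further t. What remains is the integral of \<open>beta_weighted_integral\<close>, continuous up to
  0.\<close>

lemma weighted_cont_conv: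
  assumes "weighted_cont p T k" "weighted_cont q T f" "p > -1" "q > -1"
  shows "weighted_cont (p + q + 1) T (conv k f)"
proof -
  obtain k1 where k1: "continuous_on {0..T} k1" "\<And>x. 0 < x \<Longrightarrow> x \<le> T \<Longrightarrow> k x = x powr p *\<^sub>R k1 x"
    using assms(1) by (rule weighted_contE) blast
  obtain f1 where f1: "continuous_on {0..T} f1" "\<And>x. 0 < x \<Longrightarrow> x \<le> T \<Longrightarrow> f x = x powr q *\<^sub>R f1 x"
    using assms(2) by (rule weighted_contE) blast
  show ?thesis
  proof (rule weighted_contI[OF beta_weighted_integral(2)[OF assms(3,4) k1(1) f1(1)]])
    fix t assume t: "0 < t" "t \<le> T"
    have "conv k f t = t *\<^sub>R (LBINT x:{0<..<1}. k (t - t * x) *\<^sub>R f (t * x))"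
      unfolding conv_def by (rule lborel_set_integral_scale(1)[OF t(1)])
    also have "(LBINT x:{0<..<1}. k (t - t * x) *\<^sub>R f (t * x)) =
       (LBINT x:{0<..<1}. t powr (p + q) *\<^sub>R ((1 - x) powr p * x powr q) *\<^sub>R
          k1 (t * (1 - x)) *\<^sub>R f1 (t * x))"
      by (rule set_lebesgue_integral_cong)
         (use weighted_product_scaled[OF k1(2) f1(2) t] in auto)
    also have "\<dots> = t powr (p + q) *\<^sub>R (LBINT x:{0<..<1}. ((1 - x) powr p * x powr q) *\<^sub>R
          k1 (t * (1 - x)) *\<^sub>R f1 (t * x))"
      by (rule set_integral_scaleR_right)
    finally show "conv k f t = t powr (p + q + 1) *\<^sub>R (LBINT x:{0<..<1}.
        ((1 - x) powr p * x powr q) *\<^sub>R k1 (t * (1 - x)) *\<^sub>R f1 (t * x))"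
      using t by (simp add: powr_add mult.commute)
  qed
qed

lemma weighted_cont_integrable:
  fixes f :: "real \<Rightarrow> 'a::{banach,second_countable_topology}"
  assumes "weighted_cont p T f" "p > -1" "t \<le> T"
  shows "set_integrable lborel {0<..<t} f"
  using conv_integrable[OF weighted_cont_const[of T 1] assms(1) _ assms(2,3)] by (simp add: scaleR_one)

lemma conv_add_right:
  assumes "weighted_cont p T k" "weighted_cont q T f" "weighted_cont r T g"
    "p > -1" "q > -1" "r > -1" "t \<le> T"
  shows "conv k (\<lambda>s. f s + g s) t = conv k f t + conv k g t"
  unfolding conv_def scaleR_add_right
  by (intro set_integral_add conv_integrable[OF assms(1,2)] conv_integrable[OF assms(1,3)] assms)

lemma conv_add_left:
  assumes "weighted_cont p T k" "weighted_cont q T k'" "weighted_cont r T f"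
    "p > -1" "q > -1" "r > -1" "t \<le> T"
  shows "conv (\<lambda>s. k s + k' s) f t = conv k f t + conv k' f t"
  unfolding conv_def scaleR_add_left
  by (intro set_integral_add conv_integrable[OF assms(1,3)] conv_integrable[OF assms(2,3)] assms)

lemma conv_scaleR_right: "conv k (\<lambda>s. c *\<^sub>R f s) t = c *\<^sub>R conv k f t"
  unfolding conv_def set_integral_scaleR_right[symmetric] by (simp only: scaleR_left_commute)

lemma conv_mult_left: "conv (\<lambda>s. c * k s) f t = c *\<^sub>R conv k f t"
  unfolding conv_def set_integral_scaleR_right[symmetric] by (simp only: scaleR_scaleR)

lemma conv_scaleR_const:
  assumes "weighted_cont p T k" "weighted_cont q T g" "p > -1" "q > -1" "t \<le> T"
  shows "conv k (\<lambda>s. g s *\<^sub>R c) t = conv k g t *\<^sub>R c"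
proof -
  have "integrable lborel (\<lambda>s. indicator {0<..<t} s *\<^sub>R k (t - s) *\<^sub>R g s)"
    using conv_integrable[OF assms(1,2)] assms by (simp add: set_integrable_def)
  from integral_scaleR_left[OF this, of c] show ?thesis
    by (simp add: conv_def set_lebesgue_integral_def)
qed

text \<open>Fubini on the triangle 0 < r < s < t, with \<open>fst\<close> as s and
  \<open>snd\<close> as r.\<close>

lemma conv_assoc:
  fixes f :: "real \<Rightarrow> 'a::{banach,second_countable_topology}"
  assumes k1: "weighted_cont p1 T k1" and k2: "weighted_cont p2 T k2" and f: "weighted_cont q T f"
    and "p1 > -1" "p2 > -1" "q > -1" and t: "0 < t" "t \<le> T"
  shows "conv k1 (conv k2 f) t = conv (conv k1 k2) f t"
proof -
  define A where "A = {z :: real \<times> real. 0 < snd z \<and> snd z < fst z \<and> fst z < t}"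
  define H where "H z = indicator A z *\<^sub>R ((k1 (t - fst z) * k2 (fst z - snd z)) *\<^sub>R f (snd z))" for z
  have k1c: "continuous_on {0<..T} k1" and k2c: "continuous_on {0<..T} k2"
      and fc: "continuous_on {0<..T} f"
    by (rule weighted_cont_imp_continuous_on, fact)+
  have "open A"
    unfolding A_def by (intro open_Collect_conj open_Collect_less continuous_intros)
  moreover have "continuous_on A (\<lambda>z. (k1 (t - fst z) * k2 (fst z - snd z)) *\<^sub>R f (snd z))"
    by (intro continuous_intros continuous_on_compose2[OF k1c] continuous_on_compose2[OF k2c]
          continuous_on_compose2[OF fc]) (use t in \<open>auto simp: A_def\<close>)
  ultimately have "H \<in> borel_measurable borel"
    unfolding H_def by (intro borel_measurable_continuous_on_indicator) auto
  then have meas: "H \<in> borel_measurable (lborel \<Otimes>\<^sub>M lborel)"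
    by (simp add: borel_prod measurable_cong_sets[OF sets_pair_measure_cong[OF sets_lborel sets_lborel] refl])
  have H1: "H (s, r) = indicator {0<..<t} s *\<^sub>R k1 (t - s) *\<^sub>R indicator {0<..<s} r *\<^sub>R k2 (s - r) *\<^sub>R f r"
    for s r by (auto simp: H_def A_def indicator_def)
  have H2: "H (s, r) = indicator {0<..<t} r *\<^sub>R (indicator {r<..<t} s * (k1 (t - s) * k2 (s - r))) *\<^sub>R f r"
    for s r by (auto simp: H_def A_def indicator_def)
  have "integrable (lborel \<Otimes>\<^sub>M lborel) H"
  proof (rule lborel_pair.Fubini_integrable[OF meas])
    \<comment> \<open>The inner integral of the norm is the convolution of the norms. Its exponent
      p2 + q + 1 is again above -1, so the outer integral is of the kind already known to
      converge.\<close>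
    have "set_integrable lborel {0<..<t} (\<lambda>s. norm (k1 (t - s)) *\<^sub>R
        conv (\<lambda>x. norm (k2 x)) (\<lambda>x. norm (f x)) s)"
      by (rule conv_integrable[OF weighted_cont_norm[OF k1]
            weighted_cont_conv[OF weighted_cont_norm[OF k2] weighted_cont_norm[OF f]]])
         (use assms in auto)
    then show "integrable lborel (\<lambda>s. \<integral>r. norm (H (s, r)) \<partial>lborel)"
      unfolding set_integrable_def
      by (rule Bochner_Integration.integrable_cong[THEN iffD1, rotated -1, OF _ refl])
         (simp add: H1 conv_def set_lebesgue_integral_def abs_mult mult.assoc)
    show "AE s in lborel. integrable lborel (\<lambda>r. H (s, r))"
    proof (rule AE_I2)
      fix s :: real
      show "integrable lborel (\<lambda>r. H (s, r))"
      proof (cases "s \<in> {0<..<t}")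
        case True
        have "set_integrable lborel {0<..<s} (\<lambda>r. k2 (s - r) *\<^sub>R f r)"
          by (rule conv_integrable[OF k2 f]) (use assms True in auto)
        then show ?thesis
          unfolding H1 set_integrable_def by (intro integrable_scaleR_right)
      qed (simp add: H1)
    qed
  qed
  then have "integrable (lborel \<Otimes>\<^sub>M lborel) (\<lambda>(s, r). H (s, r))"
    by simp
  from lborel_pair.Fubini_integral[OF this]
  have swap: "(\<integral>r. \<integral>s. H (s, r) \<partial>lborel \<partial>lborel) = (\<integral>s. \<integral>r. H (s, r) \<partial>lborel \<partial>lborel)" .
  have inner: "(\<integral>s. H (s, r) \<partial>lborel) = indicator {0<..<t} r *\<^sub>R conv k1 k2 (t - r) *\<^sub>R f r" for r
  proof (cases "r \<in> {0<..<t}")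
    case True
    \<comment> \<open>The shift s = r + x turns the integral over (r,t) into a convolution on
      (0,t-r).\<close>
    have eq: "indicator {r<..<t} (r + 1 * x) * (k1 (t - (r + 1 * x)) * k2 (r + 1 * x - r)) =
        indicator {0<..<t - r} x *\<^sub>R k1 (t - r - x) *\<^sub>R k2 x" for x
      by (auto simp: indicator_def algebra_simps)
    have "(\<integral>s. indicator {r<..<t} s * (k1 (t - s) * k2 (s - r)) \<partial>lborel) = conv k1 k2 (t - r)"
      using lborel_integral_real_affine[of 1 "\<lambda>s. indicator {r<..<t} s * (k1 (t - s) * k2 (s - r))" r]
      unfolding conv_def set_lebesgue_integral_def eq by simp
    moreover have "set_integrable lborel {0<..<t - r} (\<lambda>x. k1 (t - r - x) *\<^sub>R k2 x)"
      by (rule conv_integrable[OF k1 k2]) (use assms True in auto)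
    then have "integrable lborel (\<lambda>s. indicator {r<..<t} s * (k1 (t - s) * k2 (s - r)))"
      unfolding set_integrable_def eq[symmetric] by (subst (asm) lborel_integrable_real_affine_iff) auto
    ultimately show ?thesis
      unfolding H2 using True by simp
  qed (simp add: H2)
  have outer: "(\<integral>r. H (s, r) \<partial>lborel) = indicator {0<..<t} s *\<^sub>R k1 (t - s) *\<^sub>R conv k2 f s" for s
    unfolding H1 integral_scaleR_right conv_def set_lebesgue_integral_def ..
  show ?thesis
    using swap unfolding inner outer
    by (simp add: conv_def[of k1 "conv k2 f"] conv_def[of "conv k1 k2" f] set_lebesgue_integral_def)
qed

section \<open>Mittag-Leffler kernels\<close>

lemma rGamma_le_exp_powr:
  fixes x R :: real
  assumes "x \<ge> 1" "R > 0"
  shows "rGamma x \<le> exp (R + 1) * R powr (1 - x)"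
proof -
  \<comment> \<open>Bound the Gamma integral from below by its part over \<open>[R, R+1]\<close>.\<close>
  have "((\<lambda>t. if t \<in> {R..R + 1} then R powr (x - 1) / exp (R + 1) else 0) has_integral
          measure lborel {R..R + 1} *\<^sub>R (R powr (x - 1) / exp (R + 1))) {0..}"
    using has_integral_const_real[of "R powr (x - 1) / exp (R + 1)" R "R + 1"] assms
    by (subst has_integral_restrict) auto
  moreover have "((\<lambda>t. t powr (x - 1) / exp t) has_integral Gamma x) {0..}"
    using assms by (intro Gamma_integral_real) auto
  ultimately have "measure lborel {R..R + 1} *\<^sub>R (R powr (x - 1) / exp (R + 1)) \<le> Gamma x"
  proof (rule has_integral_le)
    fix t :: real
    assume "t \<in> {0..}"
    then show "(if t \<in> {R..R + 1} then R powr (x - 1) / exp (R + 1) else 0) \<le> t powr (x - 1) / exp t"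
      using assms by (auto intro!: frac_le powr_mono2)
  qed
  then have le: "R powr (x - 1) / exp (R + 1) \<le> Gamma x"
    by simp
  have "rGamma x = inverse (Gamma x)"
    by (simp add: Gamma_def)
  also have "\<dots> \<le> inverse (R powr (x - 1) / exp (R + 1))"
    using le assms by (intro le_imp_inverse_le) auto
  also have "\<dots> = exp (R + 1) * R powr (1 - x)"
    using powr_minus_divide[of R "x - 1"] by simp
  finally show ?thesis .
qed

lemma rGamma_pos: "x > 0 \<Longrightarrow> rGamma x > (0::real)"
  using Gamma_real_pos[of x] by (simp add: Gamma_def)

lemma summable_mittag_leffler:
  fixes z :: real
  assumes "\<alpha> > 0"
  shows "summable (\<lambda>k. rGamma (\<alpha> * real k + \<delta>) * z ^ k)"
proof -
  \<comment> \<open>\<open>B\<close> makes |z|/B at most 1/2, and \<open>R\<close> solves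
    \<open>R powr \<alpha> = B\<close>, so that \<open>rGamma_le_exp_powr\<close> bounds the k-th
    coefficient by a constant over B^k. Since R is free, any z can be beaten. The bound requires
    \<alpha> k + \<delta> \<ge> 1, so the comparison is only eventual.\<close>
  define B where "B = 2 * \<bar>z\<bar> + 1"
  define R where "R = B powr (1 / \<alpha>)"
  have B: "B > 0" "\<bar>z\<bar> / B \<le> 1 / 2" by (auto simp: B_def field_simps)
  have R: "R > 0" "R powr \<alpha> = B" using B assms by (auto simp: R_def powr_powr)
  define C where "C = exp (R + 1) * R powr (1 - \<delta>)"
  show ?thesis
  proof (rule summable_comparison_test_ev)
    have "filterlim (\<lambda>k. \<delta> + \<alpha> * real k) at_top sequentially"
      by (intro filterlim_tendsto_add_at_top[OF tendsto_const]
            filterlim_tendsto_pos_mult_at_top[OF tendsto_const] assms filterlim_real_sequentially)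
    then have "eventually (\<lambda>k. \<alpha> * real k + \<delta> \<ge> 1) sequentially"
      by (simp add: filterlim_at_top add.commute)
    then show "eventually (\<lambda>k. norm (rGamma (\<alpha> * real k + \<delta>) * z ^ k) \<le> C * (1 / 2) ^ k) sequentially"
    proof eventually_elim
      case (elim k)
      have "R powr (1 - (\<alpha> * real k + \<delta>)) = R powr (1 - \<delta>) / R powr (\<alpha> * real k)"
        by (simp flip: powr_diff add: algebra_simps)
      also have "R powr (\<alpha> * real k) = B ^ k"
        using R B by (simp flip: powr_powr add: powr_realpow)
      finally have eq: "R powr (1 - (\<alpha> * real k + \<delta>)) = R powr (1 - \<delta>) / B ^ k" .
      have "norm (rGamma (\<alpha> * real k + \<delta>) * z ^ k) = rGamma (\<alpha> * real k + \<delta>) * \<bar>z\<bar> ^ k"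
        using rGamma_pos[of "\<alpha> * real k + \<delta>"] elim by (simp add: abs_mult power_abs)
      also have "\<dots> \<le> (exp (R + 1) * R powr (1 - (\<alpha> * real k + \<delta>))) * \<bar>z\<bar> ^ k"
        by (intro mult_right_mono rGamma_le_exp_powr elim R) auto
      also have "\<dots> = C * (\<bar>z\<bar> / B) ^ k"
        unfolding eq C_def by (simp add: power_divide)
      also have "\<dots> \<le> C * (1 / 2) ^ k"
        using B by (intro mult_left_mono power_mono) (auto simp: C_def)
      finally show ?case .
    qed
    show "summable (\<lambda>k. C * (1 / 2) ^ k)"
      by (intro summable_mult summable_geometric) auto
  qed
qed

lemma mittag_leffler_real: "mittag_leffler \<alpha> \<delta> z = (\<Sum>k. rGamma (\<alpha> * real k + \<delta>) * z ^ k)" for z :: real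
  by (simp add: mittag_leffler_def)

text \<open>Splits off the term k = 0. At a pole of Gamma this term is 0, which matters for the
  indices 0 and -1 later on.\<close>

lemma mittag_leffler_shift:
  fixes z :: real
  assumes "\<alpha> > 0"
  shows "mittag_leffler \<alpha> \<delta> z = rGamma \<delta> + z * mittag_leffler \<alpha> (\<delta> + \<alpha>) z"
proof -
  have "mittag_leffler \<alpha> \<delta> z - rGamma \<delta> = (\<Sum>k. rGamma (\<alpha> * real (Suc k) + \<delta>) * z ^ Suc k)"
    unfolding mittag_leffler_real using suminf_split_head[OF summable_mittag_leffler[OF assms, of \<delta> z]] by simp
  also have "\<dots> = (\<Sum>k. z * (rGamma (\<alpha> * real k + (\<delta> + \<alpha>)) * z ^ k))"
    by (intro suminf_cong) (simp add: algebra_simps)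
  also have "\<dots> = z * mittag_leffler \<alpha> (\<delta> + \<alpha>) z"
    unfolding mittag_leffler_real by (rule suminf_mult[OF summable_mittag_leffler[OF assms]])
  finally show ?thesis by simp
qed

text \<open>Coefficientwise this is (\<alpha> k + \<delta> - 1) / \<Gamma>(\<alpha> k + \<delta>) =
  1 / \<Gamma>(\<alpha> k + \<delta> - 1), the recurrence of \<open>rGamma\<close>, which also holds
  at the poles. The derivative \<open>D\<close> stays abstract, and no division by z occurs, so z =
  0 is included.\<close>

lemma mittag_leffler_deriv:
  fixes z :: real
  assumes "\<alpha> > 0"
  obtains D where "(mittag_leffler \<alpha> \<delta> has_field_derivative D) (at z)"
    "(\<delta> - 1) * mittag_leffler \<alpha> \<delta> z + \<alpha> * z * D = mittag_leffler \<alpha> (\<delta> - 1) z"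
proof -
  let ?c = "\<lambda>k. rGamma (\<alpha> * real k + \<delta>)"
  note s = summable_mittag_leffler[OF assms, of \<delta>]
  have D: "((\<lambda>x. \<Sum>n. ?c n * x ^ n) has_field_derivative (\<Sum>n. diffs ?c n * z ^ n)) (at z)"
    by (rule termdiffs_strong_converges_everywhere[OF s])
  have "(\<lambda>n. z * (of_nat n * ?c n * z ^ (n - Suc 0))) sums (z * (\<Sum>n. diffs ?c n * z ^ n))"
    by (intro sums_mult diffs_equiv termdiff_converges_all s)
  also have "(\<lambda>n. z * (of_nat n * ?c n * z ^ (n - Suc 0))) = (\<lambda>n. of_nat n * ?c n * z ^ n)"
  proof
    show "z * (of_nat n * ?c n * z ^ (n - Suc 0)) = of_nat n * ?c n * z ^ n" for n
      by (cases n) auto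
  qed
  finally have 1: "(\<lambda>n. of_nat n * ?c n * z ^ n) sums (z * (\<Sum>n. diffs ?c n * z ^ n))" .
  have 2: "(\<lambda>n. ?c n * z ^ n) sums mittag_leffler \<alpha> \<delta> z"
    unfolding mittag_leffler_real using s by (rule summable_sums)
  have "(\<lambda>n. (\<delta> - 1) * (?c n * z ^ n) + \<alpha> * (of_nat n * ?c n * z ^ n)) sums
      ((\<delta> - 1) * mittag_leffler \<alpha> \<delta> z + \<alpha> * (z * (\<Sum>n. diffs ?c n * z ^ n)))"
    by (intro sums_add sums_mult 1 2)
  also have "(\<lambda>n. (\<delta> - 1) * (?c n * z ^ n) + \<alpha> * (of_nat n * ?c n * z ^ n)) =
      (\<lambda>n. rGamma (\<alpha> * real n + (\<delta> - 1)) * z ^ n)"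
  proof
    fix n
    show "(\<delta> - 1) * (?c n * z ^ n) + \<alpha> * (of_nat n * ?c n * z ^ n) = rGamma (\<alpha> * real n + (\<delta> - 1)) * z ^ n"
    proof -
      have "(\<alpha> * real n + (\<delta> - 1)) * ?c n = rGamma (\<alpha> * real n + (\<delta> - 1))"
        using rGamma_plus1[of "\<alpha> * real n + (\<delta> - 1)"] by (simp add: add.assoc)
      then show ?thesis
        by (simp flip: \<open>(\<alpha> * real n + (\<delta> - 1)) * ?c n = _\<close>) (simp add: algebra_simps)
    qed
  qed
  finally have "(\<delta> - 1) * mittag_leffler \<alpha> \<delta> z + \<alpha> * (z * (\<Sum>n. diffs ?c n * z ^ n)) =
      mittag_leffler \<alpha> (\<delta> - 1) z"
    unfolding mittag_leffler_real[of \<alpha> "\<delta> - 1"] by (rule sums_unique)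
  moreover have "mittag_leffler \<alpha> \<delta> = (\<lambda>x::real. \<Sum>n. ?c n * x ^ n)"
    by (simp add: fun_eq_iff mittag_leffler_real)
  ultimately show thesis
    using D by (intro that) (auto simp: mult.assoc)
qed

lemma continuous_on_mittag_leffler:
  assumes "\<alpha> > 0"
  shows "continuous_on A (mittag_leffler \<alpha> \<delta> :: real \<Rightarrow> real)"
proof (rule continuous_at_imp_continuous_on, rule ballI)
  fix z :: real
  show "isCont (mittag_leffler \<alpha> \<delta>) z"
    by (rule mittag_leffler_deriv[OF assms, of \<delta> z]) (erule DERIV_isCont)
qed

definition ml_kernel :: "real \<Rightarrow> real \<Rightarrow> real \<Rightarrow> real \<Rightarrow> real" where
  "ml_kernel \<alpha> m \<delta> t = t powr (\<delta> - 1) * mittag_leffler \<alpha> \<delta> (m * t powr \<alpha>)"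

text \<open>The convolution kernel of the fractional integral and at the same time the case m = 0 of
  \<open>ml_kernel\<close>, so facts about the latter specialise to it. With \<open>rGamma\<close>
  it vanishes identically at \<beta> = 0, -1, ...\<close>

definition rl_kernel :: "real \<Rightarrow> real \<Rightarrow> real" where
  "rl_kernel \<beta> t = rGamma \<beta> * t powr (\<beta> - 1)"

lemma ml_kernel_0: "\<alpha> > 0 \<Longrightarrow> ml_kernel \<alpha> 0 \<delta> = rl_kernel \<delta>"
  using mittag_leffler_shift[of \<alpha> \<delta> 0] by (simp add: fun_eq_iff ml_kernel_def rl_kernel_def)

lemma ml_kernel_shift:
  assumes "\<alpha> > 0" "t > 0"
  shows "ml_kernel \<alpha> m \<delta> t = rl_kernel \<delta> t + m * ml_kernel \<alpha> m (\<delta> + \<alpha>) t"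
proof -
  have "t powr (\<delta> + \<alpha> - 1) = t powr (\<delta> - 1) * t powr \<alpha>"
    unfolding powr_add[symmetric] by (rule arg_cong[where f = "(powr) t"]) simp
  then show ?thesis
    using mittag_leffler_shift[OF assms(1), of \<delta> "m * t powr \<alpha>"]
    unfolding ml_kernel_def rl_kernel_def by (simp add: algebra_simps)
qed

text \<open>The product rule yields t to the power \<delta> - 2 times exactly the combination
  evaluated in \<open>mittag_leffler_deriv\<close>. There is no restriction on \<delta>;
  integrability at 0 is a separate matter.\<close>

lemma ml_kernel_has_real_derivative:
  assumes "\<alpha> > 0" "t > 0"
  shows "(ml_kernel \<alpha> m \<delta> has_real_derivative ml_kernel \<alpha> m (\<delta> - 1) t) (at t within A)"
proof -
  obtain D where D: "(mittag_leffler \<alpha> \<delta> has_field_derivative D) (at (m * t powr \<alpha>))"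
    "(\<delta> - 1) * mittag_leffler \<alpha> \<delta> (m * t powr \<alpha>) + \<alpha> * (m * t powr \<alpha>) * D =
       mittag_leffler \<alpha> (\<delta> - 1) (m * t powr \<alpha>)"
    by (rule mittag_leffler_deriv[OF assms(1), of \<delta> "m * t powr \<alpha>"])
  have *: "((\<lambda>t. mittag_leffler \<alpha> \<delta> (m * t powr \<alpha>)) has_real_derivative D * (m * (\<alpha> * t powr (\<alpha> - 1))))
      (at t within A)"
    by (rule DERIV_chain2[where g = "\<lambda>t. m * t powr \<alpha>", OF D(1)]) (use assms in \<open>auto intro!: derivative_eq_intros\<close>)
  have "((\<lambda>t. t powr (\<delta> - 1) * mittag_leffler \<alpha> \<delta> (m * t powr \<alpha>)) has_real_derivative
      (\<delta> - 1) * t powr (\<delta> - 1 - 1) * mittag_leffler \<alpha> \<delta> (m * t powr \<alpha>) +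
      t powr (\<delta> - 1) * (D * (m * (\<alpha> * t powr (\<alpha> - 1))))) (at t within A)"
    using assms by (auto intro!: derivative_eq_intros *)
  moreover have "(\<delta> - 1) * t powr (\<delta> - 1 - 1) * mittag_leffler \<alpha> \<delta> (m * t powr \<alpha>) +
      t powr (\<delta> - 1) * (D * (m * (\<alpha> * t powr (\<alpha> - 1)))) = ml_kernel \<alpha> m (\<delta> - 1) t"
    unfolding ml_kernel_def D(2)[symmetric]
  proof -
    have *: "t powr (\<delta> - 1) * t powr (\<alpha> - 1) = t powr (\<delta> - 1 - 1) * t powr \<alpha>"
      unfolding powr_add[symmetric] by (rule arg_cong[where f = "(powr) t"]) simp
    have "t powr (\<delta> - 1) * (D * (m * (\<alpha> * t powr (\<alpha> - 1)))) =
        D * m * \<alpha> * (t powr (\<delta> - 1) * t powr (\<alpha> - 1))"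
      by simp
    then show "(\<delta> - 1) * t powr (\<delta> - 1 - 1) * mittag_leffler \<alpha> \<delta> (m * t powr \<alpha>) +
        t powr (\<delta> - 1) * (D * (m * (\<alpha> * t powr (\<alpha> - 1)))) =
        t powr (\<delta> - 1 - 1) * ((\<delta> - 1) * mittag_leffler \<alpha> \<delta> (m * t powr \<alpha>) + \<alpha> * (m * t powr \<alpha>) * D)"
      unfolding * by (simp add: algebra_simps)
  qed
  ultimately show ?thesis
    by (simp add: ml_kernel_def[abs_def])
qed

lemma weighted_cont_ml_kernel:
  assumes "\<alpha> > 0"
  shows "weighted_cont (\<delta> - 1) T (ml_kernel \<alpha> m \<delta>)"
proof (rule weighted_contI)
  show "continuous_on {0..T} (\<lambda>t. mittag_leffler \<alpha> \<delta> (m * t powr \<alpha>) :: real)"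
    by (intro continuous_on_compose2[OF continuous_on_mittag_leffler[OF assms, of UNIV]]
          continuous_intros continuous_on_powr') (use assms in auto)
qed (simp add: ml_kernel_def)

lemma weighted_cont_rl_kernel: "weighted_cont (\<beta> - 1) T (rl_kernel \<beta>)"
  using weighted_cont_ml_kernel[of 1 \<beta> T 0] by (simp add: ml_kernel_0)

text \<open>Scaling to the unit interval leaves B(\<delta>,\<beta>), whose numerator cancels the two
  reciprocal Gamma factors.\<close>

lemma conv_rl_kernel:
  assumes "\<beta> > 0" "\<delta> > 0" "t > 0"
  shows "conv (rl_kernel \<beta>) (rl_kernel \<delta>) t = rl_kernel (\<beta> + \<delta>) t"
proof -
  have "conv (rl_kernel \<beta>) (rl_kernel \<delta>) t =
      t *\<^sub>R (LBINT x:{0<..<1}. rl_kernel \<beta> (t - t * x) *\<^sub>R rl_kernel \<delta> (t * x))"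
    unfolding conv_def by (rule lborel_set_integral_scale(1)[OF assms(3)])
  also have "(LBINT x:{0<..<1}. rl_kernel \<beta> (t - t * x) *\<^sub>R rl_kernel \<delta> (t * x)) =
     (LBINT x:{0<..<1}. t powr (\<beta> - 1 + (\<delta> - 1)) *\<^sub>R ((1 - x) powr (\<beta> - 1) * x powr (\<delta> - 1)) *\<^sub>R
        rGamma \<beta> *\<^sub>R rGamma \<delta>)"
    by (rule set_lebesgue_integral_cong)
      (use weighted_product_scaled[of t "rl_kernel \<beta>" "\<beta> - 1" "\<lambda>_. rGamma \<beta>" "rl_kernel \<delta>" "\<delta> - 1"
           "\<lambda>_. rGamma \<delta>" t] assms in \<open>auto simp: rl_kernel_def mult.commute\<close>)
  also have "\<dots> = t powr (\<beta> - 1 + (\<delta> - 1)) *\<^sub>R rGamma \<beta> *\<^sub>R rGamma \<delta> *\<^sub>R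
      (LBINT x:{0<..<1}. (1 - x) powr (\<beta> - 1) * x powr (\<delta> - 1))"
    unfolding set_integral_scaleR_right[symmetric]
    by (intro set_lebesgue_integral_cong) (auto simp: mult_ac)
  also have "(LBINT x:{0<..<1}. (1 - x) powr (\<beta> - 1) * x powr (\<delta> - 1)) = Beta \<delta> \<beta>"
    using has_bochner_integral_beta[of "\<beta> - 1" "\<delta> - 1"] assms
    by (simp add: has_bochner_integral_iff set_lebesgue_integral_def)
  also have "rGamma \<beta> *\<^sub>R rGamma \<delta> *\<^sub>R Beta \<delta> \<beta> = rGamma (\<beta> + \<delta>)"
    using rGamma_pos[OF assms(1)] rGamma_pos[OF assms(2)]
    by (simp add: Beta_altdef Gamma_def add.commute field_simps)
  also have "t *\<^sub>R t powr (\<beta> - 1 + (\<delta> - 1)) *\<^sub>R rGamma (\<beta> + \<delta>) = rl_kernel (\<beta> + \<delta>) t"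
    using assms powr_add[of t 1 "\<beta> - 1 + (\<delta> - 1)"] by (simp add: rl_kernel_def algebra_simps)
  finally show ?thesis .
qed

lemma ml_kernel_sums:
  assumes "\<alpha> > 0" "t > 0"
  shows "(\<lambda>k. m ^ k * rl_kernel (\<alpha> * real k + \<delta>) t) sums ml_kernel \<alpha> m \<delta> t"
proof -
  have "(\<lambda>k. t powr (\<delta> - 1) * (rGamma (\<alpha> * real k + \<delta>) * (m * t powr \<alpha>) ^ k)) sums ml_kernel \<alpha> m \<delta> t"
    unfolding ml_kernel_def mittag_leffler_real
    by (intro sums_mult summable_sums summable_mittag_leffler assms)
  also have "(\<lambda>k. t powr (\<delta> - 1) * (rGamma (\<alpha> * real k + \<delta>) * (m * t powr \<alpha>) ^ k)) =
      (\<lambda>k. m ^ k * rl_kernel (\<alpha> * real k + \<delta>) t)"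
  proof
    fix k
    have "t powr (\<alpha> * real k + \<delta> - 1) = t powr (\<delta> - 1) * t powr (\<alpha> * real k)"
      unfolding powr_add[symmetric] by (rule arg_cong[where f = "(powr) t"]) simp
    moreover have "(m * t powr \<alpha>) ^ k = m ^ k * t powr (\<alpha> * real k)"
      using assms by (simp add: power_mult_distrib powr_power mult.commute)
    ultimately show "t powr (\<delta> - 1) * (rGamma (\<alpha> * real k + \<delta>) * (m * t powr \<alpha>) ^ k) =
        m ^ k * rl_kernel (\<alpha> * real k + \<delta>) t"
      by (simp add: rl_kernel_def)
  qed
  finally show ?thesis .
qed

text \<open>Termwise convolution of the series of power kernels, each term being
  \<open>conv_rl_kernel\<close>. The interchange of sum and integral needs summable integrals of the
  norms.\<close>

lemma conv_rl_kernel_ml_kernel: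
  assumes "\<alpha> > 0" "\<beta> > 0" "\<delta> > 0" "t > 0"
  shows "conv (rl_kernel \<beta>) (ml_kernel \<alpha> m \<delta>) t = ml_kernel \<alpha> m (\<beta> + \<delta>) t"
proof -
  define f where "f k s = indicator {0<..<t} s *\<^sub>R
      (rl_kernel \<beta> (t - s) *\<^sub>R (m ^ k * rl_kernel (\<alpha> * real k + \<delta>) s))" for k s
  have pos: "\<alpha> * real k + \<delta> > 0" for k
    using assms by (simp add: add_nonneg_pos)
  have int: "set_integrable lborel {0<..<t} (\<lambda>s. rl_kernel \<beta> (t - s) *\<^sub>R rl_kernel (\<alpha> * real k + \<delta>) s)" for k
    using conv_integrable[OF weighted_cont_rl_kernel weighted_cont_rl_kernel, of \<beta> "\<alpha> * real k + \<delta>" t t]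
      pos[of k] assms by auto
  have val: "(LBINT s:{0<..<t}. c *\<^sub>R (rl_kernel \<beta> (t - s) *\<^sub>R rl_kernel (\<alpha> * real k + \<delta>) s)) =
        c * rl_kernel (\<alpha> * real k + (\<beta> + \<delta>)) t" for k c
    unfolding set_integral_scaleR_right conv_def[symmetric] conv_rl_kernel[OF assms(2) pos assms(4)]
    by (simp add: add_ac)
  have f_eq: "f k = (\<lambda>s. indicator {0<..<t} s *\<^sub>R
      (m ^ k *\<^sub>R (rl_kernel \<beta> (t - s) *\<^sub>R rl_kernel (\<alpha> * real k + \<delta>) s)))" for k
    by (auto simp: f_def fun_eq_iff)
  \<comment> \<open>All power kernels involved are nonnegative, so taking norms only replaces m by
    its absolute value. The integrals of the norms then form the convergent series of
    \<open>ml_kernel\<close> for |m| at index \<beta> + \<delta>.\<close>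
  have nf_eq: "norm (f k s) = indicator {0<..<t} s *\<^sub>R
      (\<bar>m\<bar> ^ k *\<^sub>R (rl_kernel \<beta> (t - s) *\<^sub>R rl_kernel (\<alpha> * real k + \<delta>) s))" for k s
    using rGamma_pos[OF assms(2)] rGamma_pos[OF pos[of k]]
    by (auto simp: f_def rl_kernel_def abs_mult power_abs indicator_def)
  have "(\<integral>s. (\<Sum>k. f k s) \<partial>lborel) = (\<Sum>k. \<integral>s. f k s \<partial>lborel)"
  proof (rule integral_suminf)
    show "integrable lborel (f k)" for k
      unfolding f_eq using int[of k]
      by (simp only: set_integrable_def[symmetric] set_integrable_scaleR_right)
    show "AE s in lborel. summable (\<lambda>k. norm (f k s))"
    proof (rule AE_I2)
      fix s
      show "summable (\<lambda>k. norm (f k s))"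
      proof (cases "s \<in> {0<..<t}")
        case True
        have "summable (\<lambda>k. rl_kernel \<beta> (t - s) * (\<bar>m\<bar> ^ k * rl_kernel (\<alpha> * real k + \<delta>) s))"
          using ml_kernel_sums[OF assms(1), of s "\<bar>m\<bar>" \<delta>] True by (intro summable_mult) (auto simp: sums_iff)
        then show ?thesis unfolding nf_eq using True by (simp add: mult_ac)
      qed (simp only: nf_eq, simp)
    qed
    have "summable (\<lambda>k. \<bar>m\<bar> ^ k * rl_kernel (\<alpha> * real k + (\<beta> + \<delta>)) t)"
      using ml_kernel_sums[OF assms(1,4), of "\<bar>m\<bar>" "\<beta> + \<delta>"] by (simp add: sums_iff)
    then show "summable (\<lambda>k. \<integral>s. norm (f k s) \<partial>lborel)"
      unfolding nf_eq using val[unfolded set_lebesgue_integral_def] by simp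
  qed
  also have "(\<Sum>k. \<integral>s. f k s \<partial>lborel) = (\<Sum>k. m ^ k * rl_kernel (\<alpha> * real k + (\<beta> + \<delta>)) t)"
    unfolding f_eq using val[unfolded set_lebesgue_integral_def] by simp
  also have "\<dots> = ml_kernel \<alpha> m (\<beta> + \<delta>) t"
    using ml_kernel_sums[OF assms(1,4), of m "\<beta> + \<delta>"] by (simp add: sums_iff)
  finally have *: "(\<integral>s. (\<Sum>k. f k s) \<partial>lborel) = ml_kernel \<alpha> m (\<beta> + \<delta>) t" .
  have "(\<Sum>k. f k s) = indicator {0<..<t} s *\<^sub>R (rl_kernel \<beta> (t - s) *\<^sub>R ml_kernel \<alpha> m \<delta> s)" for s
  proof (cases "s \<in> {0<..<t}")
    case True
    have "(\<lambda>k. rl_kernel \<beta> (t - s) * (m ^ k * rl_kernel (\<alpha> * real k + \<delta>) s)) sums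
        (rl_kernel \<beta> (t - s) * ml_kernel \<alpha> m \<delta> s)"
      using True by (intro sums_mult ml_kernel_sums assms) auto
    then show ?thesis using True by (simp add: f_def sums_iff)
  qed (simp add: f_def)
  with * show ?thesis
    by (simp add: conv_def set_lebesgue_integral_def)
qed

section \<open>Differentiating convolutions\<close>

lemma conv_one_has_vector_derivative:
  fixes h :: "real \<Rightarrow> 'a::euclidean_space"
  assumes h: "weighted_cont q T h" "q > -1" and t: "t \<in> {0<..T}"
  shows "(conv (\<lambda>_. 1) h has_vector_derivative h t) (at t within {0<..T})"
proof -
  have eq: "conv (\<lambda>_. 1) h u = integral {0..u} h" if "u \<in> {0<..T}" for u
  proof -
    have "set_integrable lborel {0<..<u} h"
      using that by (intro weighted_cont_integrable[OF h]) auto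
    from set_borel_integral_eq_integral(2)[OF this]
    have "conv (\<lambda>_. 1) h u = integral {0<..<u} h"
      by (simp add: conv_def)
    also have "\<dots> = integral {0..u} h"
      using integral_open_interval[of 0 u h] by simp
    finally show ?thesis .
  qed
  have "h integrable_on {0<..<T}"
    by (rule set_borel_integral_eq_integral(1)[OF weighted_cont_integrable[OF h]]) simp
  then have int: "h integrable_on {0..T}"
    by (simp add: integrable_on_Icc_iff_Ioo)
  \<comment> \<open>Since t > 0, removing the point 0 does not change the filter. The fundamental
    theorem on the closed interval thus gives the derivative within the half-open one.\<close>
  have at_eq: "at t within {0..T} = at t within {0<..T}"
    by (rule at_within_nhd[of _ "{0<..}"]) (use t in auto)
  have "continuous (at t within {0<..T}) h"
    using weighted_cont_imp_continuous_on[OF h(1)] t by (simp add: continuous_on_eq_continuous_within)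
  then have "((\<lambda>u. integral {0..u} h) has_vector_derivative h t) (at t within {0..T})"
    using integral_has_vector_derivative_continuous_at[OF int, of t "{}"] t by (simp add: at_eq)
  then show ?thesis
    unfolding at_eq by (rule has_vector_derivative_transform[rotated -1]) (use t eq in auto)
qed

lemma rl_kernel_1: "s > 0 \<Longrightarrow> rl_kernel 1 s = 1"
  by (simp add: rl_kernel_def)

lemma rl_kernel_2: "s > 0 \<Longrightarrow> rl_kernel 2 s = s"
  using rGamma_plus1[of "1::real"] by (simp add: rl_kernel_def)

lemma conv_rl_kernel_1_has_vector_derivative:
  fixes h :: "real \<Rightarrow> 'a::euclidean_space"
  assumes "weighted_cont q T h" "q > -1" "t \<in> {0<..T}"
  shows "(conv (rl_kernel 1) h has_vector_derivative h t) (at t within {0<..T})"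
proof -
  have "conv (rl_kernel 1) h = conv (\<lambda>_. 1) h"
    by (intro ext conv_cong) (auto simp: rl_kernel_1)
  then show ?thesis
    using conv_one_has_vector_derivative[OF assms] by simp
qed

lemma conv_rl_kernel_conv_ml_kernel:
  fixes f :: "real \<Rightarrow> 'a::{banach,second_countable_topology}"
  assumes "\<alpha> > 0" "\<beta> > 0" "\<delta> > 0" "weighted_cont q T f" "q > -1" "0 < t" "t \<le> T"
  shows "conv (rl_kernel \<beta>) (conv (ml_kernel \<alpha> m \<delta>) f) t = conv (ml_kernel \<alpha> m (\<beta> + \<delta>)) f t"
    and "conv (ml_kernel \<alpha> m \<delta>) (conv (rl_kernel \<beta>) f) t = conv (ml_kernel \<alpha> m (\<beta> + \<delta>)) f t"
proof -
  have "conv (rl_kernel \<beta>) (conv (ml_kernel \<alpha> m \<delta>) f) t =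
      conv (conv (rl_kernel \<beta>) (ml_kernel \<alpha> m \<delta>)) f t"
    by (rule conv_assoc[OF weighted_cont_rl_kernel weighted_cont_ml_kernel assms(4)])
       (use assms in auto)
  also have "\<dots> = conv (ml_kernel \<alpha> m (\<beta> + \<delta>)) f t"
    by (intro conv_cong conv_rl_kernel_ml_kernel assms) auto
  finally show "conv (rl_kernel \<beta>) (conv (ml_kernel \<alpha> m \<delta>) f) t = conv (ml_kernel \<alpha> m (\<beta> + \<delta>)) f t" .
  have "conv (ml_kernel \<alpha> m \<delta>) (conv (rl_kernel \<beta>) f) t =
      conv (conv (ml_kernel \<alpha> m \<delta>) (rl_kernel \<beta>)) f t"
    by (rule conv_assoc[OF weighted_cont_ml_kernel weighted_cont_rl_kernel assms(4)])
       (use assms in auto)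
  also have "\<dots> = conv (ml_kernel \<alpha> m (\<beta> + \<delta>)) f t"
    by (intro conv_cong) (auto simp: conv_commute_real[of "ml_kernel \<alpha> m \<delta>"]
          intro!: conv_rl_kernel_ml_kernel assms)
  finally show "conv (ml_kernel \<alpha> m \<delta>) (conv (rl_kernel \<beta>) f) t = conv (ml_kernel \<alpha> m (\<beta> + \<delta>)) f t" .
qed

lemma weighted_cont_conv_ml_kernel:
  fixes f :: "real \<Rightarrow> 'a::{banach,second_countable_topology}"
  assumes "\<alpha> > 0" "\<delta> > 0" "weighted_cont q T f" "q > -1"
  shows "weighted_cont (\<delta> + q) T (conv (ml_kernel \<alpha> m \<delta>) f)"
  using weighted_cont_conv[OF weighted_cont_ml_kernel[OF assms(1)] assms(3), of \<delta> m] assms by simp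

text \<open>For \<delta> > 1 the convolution is the primitive of the one with index \<delta> - 1,
  because convolving with \<open>rl_kernel 1\<close> raises the index by 1.\<close>

lemma conv_ml_kernel_has_vector_derivative:
  fixes f :: "real \<Rightarrow> 'a::euclidean_space"
  assumes "\<alpha> > 0" "\<delta> > 1" "weighted_cont q T f" "q > -1" "t \<in> {0<..T}"
  shows "(conv (ml_kernel \<alpha> m \<delta>) f has_vector_derivative conv (ml_kernel \<alpha> m (\<delta> - 1)) f t)
           (at t within {0<..T})"
proof (rule has_vector_derivative_transform)
  show "(conv (rl_kernel 1) (conv (ml_kernel \<alpha> m (\<delta> - 1)) f) has_vector_derivative
      conv (ml_kernel \<alpha> m (\<delta> - 1)) f t) (at t within {0<..T})"
    by (rule conv_rl_kernel_1_has_vector_derivative[OF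
          weighted_cont_conv_ml_kernel[OF assms(1) _ assms(3,4)] _ assms(5)]) (use assms in auto)
  show "conv (ml_kernel \<alpha> m \<delta>) f u = conv (rl_kernel 1) (conv (ml_kernel \<alpha> m (\<delta> - 1)) f) u"
    if "u \<in> {0<..T}" for u
    using conv_rl_kernel_conv_ml_kernel(1)[of \<alpha> 1 "\<delta> - 1" q T f u m] assms that by auto
qed (use assms in auto)

text \<open>Separates the part that is a plain fractional integral of f. With \<delta> = 1 it gives
  access to the derivative at the index that the preceding lemma excludes; with \<delta> = 2 it
  isolates the double integral in the representation of solutions.\<close>

lemma conv_ml_kernel_shift:
  fixes f :: "real \<Rightarrow> 'a::{banach,second_countable_topology}"
  assumes "\<alpha> > 0" "\<delta> > 0" "weighted_cont q T f" "q > -1" "t \<le> T"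
  shows "conv (ml_kernel \<alpha> m \<delta>) f t =
    conv (rl_kernel \<delta>) f t + m *\<^sub>R conv (ml_kernel \<alpha> m (\<delta> + \<alpha>)) f t"
proof -
  have "conv (ml_kernel \<alpha> m \<delta>) f t = conv (\<lambda>s. rl_kernel \<delta> s + m * ml_kernel \<alpha> m (\<delta> + \<alpha>) s) f t"
    by (intro conv_cong ml_kernel_shift assms) auto
  also have "\<dots> = conv (rl_kernel \<delta>) f t + conv (\<lambda>s. m * ml_kernel \<alpha> m (\<delta> + \<alpha>) s) f t"
    by (rule conv_add_left[OF weighted_cont_rl_kernel
          weighted_cont_scaleR[OF weighted_cont_ml_kernel, unfolded real_scaleR_def] assms(3)])
       (use assms in auto)
  finally show ?thesis
    by (simp add: conv_mult_left)
qed

section \<open>The solution family and the Riemann-Liouville operators\<close>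

text \<open>The candidate solution has \<sigma> = \<alpha>. Other values of \<sigma> are its
  fractional integrals and derivatives with the same constants: integration of order \<beta> adds
  \<beta> to \<sigma>, an ordinary derivative subtracts 1.\<close>

definition ml_solution ::
    "real \<Rightarrow> real \<Rightarrow> real \<Rightarrow> 'a \<Rightarrow> 'a \<Rightarrow> (real \<Rightarrow> 'a::{banach,second_countable_topology}) \<Rightarrow> real \<Rightarrow> 'a"
  where "ml_solution \<alpha> m \<sigma> c0 c1 f t =
     ml_kernel \<alpha> m (\<sigma> - 1) t *\<^sub>R c0 + ml_kernel \<alpha> m \<sigma> t *\<^sub>R c1 + conv (ml_kernel \<alpha> m \<sigma>) f t"

lemma weighted_cont_ml_solution:
  assumes "\<alpha> > 0" "\<sigma> > 1" "weighted_cont q T f" "q > -1"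
  shows "weighted_cont (\<sigma> - 2) T (ml_solution \<alpha> m \<sigma> c0 c1 f)"
  unfolding ml_solution_def[abs_def]
proof (intro weighted_cont_add)
  show "weighted_cont (\<sigma> - 2) T (\<lambda>t. ml_kernel \<alpha> m (\<sigma> - 1) t *\<^sub>R c0)"
    using weighted_cont_scaleR_left[OF weighted_cont_ml_kernel[OF assms(1), of "\<sigma> - 1" T m]] by simp
  show "weighted_cont (\<sigma> - 2) T (\<lambda>t. ml_kernel \<alpha> m \<sigma> t *\<^sub>R c1)"
    by (rule weighted_cont_mono[OF weighted_cont_scaleR_left[OF weighted_cont_ml_kernel[OF assms(1)]]])
      simp
  show "weighted_cont (\<sigma> - 2) T (conv (ml_kernel \<alpha> m \<sigma>) f)"
    by (rule weighted_cont_mono[OF weighted_cont_conv_ml_kernel[OF assms(1) _ assms(3,4)]])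
      (use assms in auto)
qed

lemma ml_kernel_scaleR_has_vector_derivative:
  assumes "\<alpha> > 0" "t > 0"
  shows "((\<lambda>t. ml_kernel \<alpha> m \<delta> t *\<^sub>R c) has_vector_derivative ml_kernel \<alpha> m (\<delta> - 1) t *\<^sub>R c) (at t within A)"
  using has_vector_derivative_scaleR[OF ml_kernel_has_real_derivative[OF assms] has_vector_derivative_const]
  by simp

lemma ml_solution_has_vector_derivative:
  fixes f :: "real \<Rightarrow> 'a::euclidean_space"
  assumes "\<alpha> > 0" "\<sigma> > 1" "weighted_cont q T f" "q > -1" "t \<in> {0<..T}"
  shows "(ml_solution \<alpha> m \<sigma> c0 c1 f has_vector_derivative ml_solution \<alpha> m (\<sigma> - 1) c0 c1 f t)
           (at t within {0<..T})"
  unfolding ml_solution_def[abs_def]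
  by (intro has_vector_derivative_add ml_kernel_scaleR_has_vector_derivative
        conv_ml_kernel_has_vector_derivative[OF assms]) (use assms in auto)

text \<open>This is (E) at the level of the family. By the shift identity the convolution is the
  primitive of f plus m times a convolution of index 1 + \<alpha>, and both can be
  differentiated.\<close>

lemma ml_solution_1_has_vector_derivative:
  fixes f :: "real \<Rightarrow> 'a::euclidean_space"
  assumes "\<alpha> > 0" "weighted_cont q T f" "q > -1" "t \<in> {0<..T}"
  shows "(ml_solution \<alpha> m 1 c0 c1 f has_vector_derivative f t + m *\<^sub>R ml_solution \<alpha> m \<alpha> c0 c1 f t)
           (at t within {0<..T})"
proof -
  have "(ml_solution \<alpha> m 1 c0 c1 f has_vector_derivative
      ml_kernel \<alpha> m (1 - 1 - 1) t *\<^sub>R c0 + ml_kernel \<alpha> m (1 - 1) t *\<^sub>R c1 +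
      (f t + m *\<^sub>R conv (ml_kernel \<alpha> m (1 + \<alpha> - 1)) f t)) (at t within {0<..T})"
    unfolding ml_solution_def[abs_def]
  proof (intro has_vector_derivative_add ml_kernel_scaleR_has_vector_derivative)
    show "(conv (ml_kernel \<alpha> m 1) f has_vector_derivative f t + m *\<^sub>R conv (ml_kernel \<alpha> m (1 + \<alpha> - 1)) f t)
        (at t within {0<..T})"
    proof (rule has_vector_derivative_transform)
      show "((\<lambda>t. conv (rl_kernel 1) f t + m *\<^sub>R conv (ml_kernel \<alpha> m (1 + \<alpha>)) f t) has_vector_derivative
          f t + m *\<^sub>R conv (ml_kernel \<alpha> m (1 + \<alpha> - 1)) f t) (at t within {0<..T})"
        by (intro has_vector_derivative_add conv_rl_kernel_1_has_vector_derivative[OF assms(2-4)]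
              bounded_linear.has_vector_derivative[OF bounded_linear_scaleR_right]
              conv_ml_kernel_has_vector_derivative[OF assms(1) _ assms(2-4)]) (use assms in auto)
    qed (use assms conv_ml_kernel_shift[OF assms(1) _ assms(2,3), of 1] in auto)
  qed (use assms in auto)
  \<comment> \<open>The kernels of index -1 and 0 lose their leading power because 1/\<Gamma>
    vanishes there. Only m times the kernels of index \<alpha> - 1 and \<alpha> remains.\<close>
  moreover have "rGamma (-1 :: real) = 0"
    by (simp add: rGamma_eq_zero_iff)
  then have "ml_kernel \<alpha> m (1 - 1 - 1) t = m * ml_kernel \<alpha> m (\<alpha> - 1) t"
      "ml_kernel \<alpha> m (1 - 1) t = m * ml_kernel \<alpha> m \<alpha> t"
    using ml_kernel_shift[OF assms(1), of t m "-1"] ml_kernel_shift[OF assms(1), of t m "0"] assms(4)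
    by (simp_all add: rl_kernel_def)
  ultimately show ?thesis
    by (simp add: ml_solution_def scaleR_add_right add_ac)
qed

lemma lborel_set_integral_Icc_eq_Ioo:
  fixes F :: "real \<Rightarrow> 'a::{banach,second_countable_topology}"
  shows "(LBINT s:{0..t}. F s) = (LBINT s:{0<..<t}. F s)"
  unfolding set_lebesgue_integral_def
  by (rule integral_discrete_difference[where X = "{0, t}"]) (auto simp: indicator_def)

lemma rl_integral_eq_conv:
  assumes "\<beta> > 0"
  shows "rl_integral \<beta> u t = conv (rl_kernel \<beta>) u t"
proof -
  have "1 / Gamma \<beta> = rGamma \<beta>"
    by (simp add: Gamma_def divide_inverse)
  then show ?thesis
    using assms conv_mult_left[of "rGamma \<beta>" "\<lambda>s. s powr (\<beta> - 1)" u t]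
    by (simp add: rl_integral_def lborel_set_integral_Icc_eq_Ioo conv_def[symmetric] rl_kernel_def[abs_def]
          flip: conv_def[of "\<lambda>s. s powr (\<beta> - 1)"])
qed

lemma rl_integral_cong:
  assumes "\<beta> \<ge> 0" "t > 0" "\<And>s. 0 < s \<Longrightarrow> s \<le> t \<Longrightarrow> u s = v s"
  shows "rl_integral \<beta> u t = rl_integral \<beta> v t"
proof (cases "\<beta> = 0")
  case True
  then show ?thesis using assms by (simp add: rl_integral_def)
next
  case False
  then show ?thesis
    using assms by (simp add: rl_integral_eq_conv) (rule conv_cong, auto)
qed

text \<open>The condition \<sigma> > 1 makes even the kernel of index \<sigma> - 1 integrable at 0,
  so each of the three parts can be convolved. For \<beta> = 0 the operator is the identity and not
  a convolution.\<close>

lemma rl_integral_ml_solution: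
  assumes "\<alpha> > 0" "\<beta> \<ge> 0" "\<sigma> > 1" "weighted_cont q T f" "q > -1" "0 < t" "t \<le> T"
  shows "rl_integral \<beta> (ml_solution \<alpha> m \<sigma> c0 c1 f) t = ml_solution \<alpha> m (\<beta> + \<sigma>) c0 c1 f t"
proof (cases "\<beta> = 0")
  case False
  let ?K = "rl_kernel \<beta>"
  have K: "weighted_cont (\<beta> - 1) T ?K" "\<beta> - 1 > -1" by (auto intro: weighted_cont_rl_kernel simp: False)
     (use assms False in auto)
  have w: "weighted_cont (\<sigma> - 1 - 1) T (ml_kernel \<alpha> m (\<sigma> - 1))" "weighted_cont (\<sigma> - 1) T (ml_kernel \<alpha> m \<sigma>)"
    by (intro weighted_cont_ml_kernel assms)+
  have wc: "weighted_cont (\<sigma> + q) T (conv (ml_kernel \<alpha> m \<sigma>) f)"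
    by (intro weighted_cont_conv_ml_kernel assms) (use assms in auto)
  have "conv ?K (ml_solution \<alpha> m \<sigma> c0 c1 f) t =
      conv ?K (\<lambda>s. ml_kernel \<alpha> m (\<sigma> - 1) s *\<^sub>R c0 + ml_kernel \<alpha> m \<sigma> s *\<^sub>R c1) t +
      conv ?K (conv (ml_kernel \<alpha> m \<sigma>) f) t"
    unfolding ml_solution_def[abs_def]
    by (rule conv_add_right[OF K(1) weighted_cont_add[OF
          weighted_cont_scaleR_left[OF w(1)] weighted_cont_scaleR_left[OF weighted_cont_mono[OF w(2)]]] wc])
       (use assms K in auto)
  also have "conv ?K (\<lambda>s. ml_kernel \<alpha> m (\<sigma> - 1) s *\<^sub>R c0 + ml_kernel \<alpha> m \<sigma> s *\<^sub>R c1) t =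
      conv ?K (\<lambda>s. ml_kernel \<alpha> m (\<sigma> - 1) s *\<^sub>R c0) t + conv ?K (\<lambda>s. ml_kernel \<alpha> m \<sigma> s *\<^sub>R c1) t"
    by (rule conv_add_right[OF K(1) weighted_cont_scaleR_left[OF w(1)] weighted_cont_scaleR_left[OF w(2)]])
       (use assms K in auto)
  also have "conv ?K (\<lambda>s. ml_kernel \<alpha> m (\<sigma> - 1) s *\<^sub>R c0) t = ml_kernel \<alpha> m (\<beta> + \<sigma> - 1) t *\<^sub>R c0"
    using conv_scaleR_const[OF K(1) w(1), where t = t] conv_rl_kernel_ml_kernel[of \<alpha> \<beta> "\<sigma> - 1" t m] assms K
    by (simp add: add_diff_eq)
  also have "conv ?K (\<lambda>s. ml_kernel \<alpha> m \<sigma> s *\<^sub>R c1) t = ml_kernel \<alpha> m (\<beta> + \<sigma>) t *\<^sub>R c1"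
    using conv_scaleR_const[OF K(1) w(2), where t = t] conv_rl_kernel_ml_kernel[of \<alpha> \<beta> \<sigma> t m] assms K by simp
  also have "conv ?K (conv (ml_kernel \<alpha> m \<sigma>) f) t = conv (ml_kernel \<alpha> m (\<beta> + \<sigma>)) f t"
    using conv_rl_kernel_conv_ml_kernel(1)[of \<alpha> \<beta> \<sigma> q T f t m] assms K by simp
  finally show ?thesis
    using K by (simp add: rl_integral_eq_conv ml_solution_def[abs_def])
qed (simp add: rl_integral_def)

text \<open>Explicit candidates \<open>G k\<close> replace the recursively chosen values of
  \<open>vector_derivative\<close>. Nontrivial limits make derivatives within S unique, and
  agreement of F with \<open>G 0\<close> on S alone suffices.\<close>

lemma nth_vderiv_chain:
  fixes G :: "nat \<Rightarrow> real \<Rightarrow> 'a::real_normed_vector"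
  assumes D: "\<And>k x. k < n \<Longrightarrow> x \<in> S \<Longrightarrow> (G k has_vector_derivative G (Suc k) x) (at x within S)"
    and S: "\<And>x. x \<in> S \<Longrightarrow> at x within S \<noteq> bot"
    and F: "\<And>x. x \<in> S \<Longrightarrow> F x = G 0 x"
  shows "times_differentiable_on n F S"
    and "\<And>k x. k \<le> n \<Longrightarrow> x \<in> S \<Longrightarrow> nth_vderiv S k F x = G k x"
proof -
  have *: "(nth_vderiv S k F has_vector_derivative G (Suc k) x) (at x within S)"
    if eq: "\<And>y. y \<in> S \<Longrightarrow> nth_vderiv S k F y = G k y" and "k < n" "x \<in> S" for k x
    by (rule has_vector_derivative_transform[OF _ _ D]) (use that in auto)
  show eq: "nth_vderiv S k F x = G k x" if "k \<le> n" "x \<in> S" for k x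
    using that
  proof (induction k arbitrary: x)
    case (Suc k)
    then show ?case
      using vector_derivative_within[OF S *] by simp
  qed (simp add: F)
  show "times_differentiable_on n F S"
    unfolding times_differentiable_on_def differentiable_on_def
  proof (intro allI impI ballI)
    fix k x assume "k < n" "x \<in> S"
    then have "(nth_vderiv S k F has_vector_derivative G (Suc k) x) (at x within S)"
      using * eq by simp
    then show "nth_vderiv S k F differentiable at x within S"
      by (auto simp: has_vector_derivative_def intro: differentiableI)
  qed
qed

text \<open>Reconciles \<open>rl_deriv\<close>, which differentiates in \<open>UNIV\<close>, with
  differentiability on S. Derivatives are local, and the induction keeps equality on a whole
  neighbourhood.\<close>

lemma nth_vderiv_open:
  assumes "open S" "x \<in> S"
  shows "nth_vderiv UNIV k F x = nth_vderiv S k F x"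
  using assms(2)
proof (induction k arbitrary: x)
  case (Suc k)
  have "eventually (\<lambda>y. y \<in> S) (nhds x)"
    using assms Suc.prems by (simp add: eventually_nhds_in_open)
  then have "eventually (\<lambda>y. nth_vderiv UNIV k F y = nth_vderiv S k F y) (nhds x)"
    by eventually_elim (rule Suc.IH)
  then have "vector_derivative (nth_vderiv UNIV k F) (at x) = vector_derivative (nth_vderiv S k F) (at x)"
    by (intro vector_derivative_cong_eq) (auto elim: eventually_mono)
  then show ?case
    by (simp add: at_within_open[OF Suc.prems assms(1)])
qed simp

lemma times_differentiable_on_has_vector_derivative:
  assumes "times_differentiable_on n F S" "k < n" "x \<in> S"
  shows "(nth_vderiv S k F has_vector_derivative nth_vderiv S (Suc k) F x) (at x within S)"
  using assms by (auto simp: times_differentiable_on_def differentiable_on_def vector_derivative_works)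

text \<open>The integer and non-integer branches give the same order on this range, so \<alpha> = 2
  needs no separate treatment; likewise \<gamma> = 1 in the next lemma.\<close>

lemma rl_order_eq_2: "1 < \<alpha> \<Longrightarrow> \<alpha> \<le> 2 \<Longrightarrow> rl_order \<alpha> = 2"
proof (cases "\<alpha> = 2")
  case False
  assume "1 < \<alpha>" "\<alpha> \<le> 2"
  with False have "\<lfloor>\<alpha>\<rfloor> = 1" by linarith
  moreover from this \<open>1 < \<alpha>\<close> have "\<alpha> \<notin> \<int>"
    by (auto elim!: Ints_cases)
  ultimately show ?thesis by (simp add: rl_order_def)
qed (auto simp: rl_order_def)

lemma rl_order_eq_1: "0 < \<gamma> \<Longrightarrow> \<gamma> \<le> 1 \<Longrightarrow> rl_order \<gamma> = 1"
proof (cases "\<gamma> = 1")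
  case False
  assume "0 < \<gamma>" "\<gamma> \<le> 1"
  with False have "\<lfloor>\<gamma>\<rfloor> = 0" by linarith
  moreover from this \<open>0 < \<gamma>\<close> have "\<gamma> \<notin> \<int>"
    by (auto elim!: Ints_cases)
  ultimately show ?thesis by (simp add: rl_order_def)
qed (auto simp: rl_order_def)

lemma at_within_Ioo_neq_bot: "x \<in> {0<..<T::real} \<Longrightarrow> at x within {0<..<T} \<noteq> bot"
  using at_within_open[of x "{0<..<T}"] by simp

lemma at_within_Ioc_neq_bot: "x \<in> {0<..T::real} \<Longrightarrow> at x within {0<..T} \<noteq> bot"
proof -
  assume x: "x \<in> {0<..T}"
  have "x islimpt {0<..<x}"
    using x by (simp add: islimpt_greaterThanLessThan2)
  then have "x islimpt {0<..T}"
    by (rule islimpt_subset) (use x in auto)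
  then show ?thesis
    by (simp add: trivial_limit_within)
qed

text \<open>Index bookkeeping. For order \<alpha>, integration of order 2 - \<alpha> leads to
  \<sigma> = 2, and two derivatives lead through \<sigma> = 1 to f + m u. For order \<gamma>,
  integration of order 1 - \<gamma> and one derivative lead to \<sigma> = \<alpha> -
  \<gamma>.\<close>

lemma ml_solution_rl_derivs:
  fixes f :: "real \<Rightarrow> 'a::euclidean_space"
  assumes \<alpha>: "1 < \<alpha>" "\<alpha> \<le> 2" and f: "weighted_cont q T f" "q > -1"
    and u: "\<And>t. t \<in> {0<..T} \<Longrightarrow> u t = ml_solution \<alpha> m \<alpha> c0 c1 f t"
  shows "\<And>\<beta> t. \<beta> \<ge> 0 \<Longrightarrow> t \<in> {0<..T} \<Longrightarrow> rl_integral \<beta> u t = ml_solution \<alpha> m (\<beta> + \<alpha>) c0 c1 f t"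
    and "rl_differentiable_on \<alpha> u {0<..<T}"
    and "\<And>t. t \<in> {0<..<T} \<Longrightarrow> rl_deriv \<alpha> u t = f t + m *\<^sub>R u t"
    and "\<And>\<gamma>. 0 < \<gamma> \<Longrightarrow> \<gamma> \<le> \<alpha> - 1 \<Longrightarrow> rl_differentiable_on \<gamma> u {0<..<T}"
    and "\<And>\<gamma> t. 0 < \<gamma> \<Longrightarrow> \<gamma> \<le> \<alpha> - 1 \<Longrightarrow> t \<in> {0<..<T} \<Longrightarrow>
           rl_deriv \<gamma> u t = ml_solution \<alpha> m (\<alpha> - \<gamma>) c0 c1 f t"
proof -
  show int: "rl_integral \<beta> u t = ml_solution \<alpha> m (\<beta> + \<alpha>) c0 c1 f t" if "\<beta> \<ge> 0" "t \<in> {0<..T}" for \<beta> t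
  proof -
    have "rl_integral \<beta> u t = rl_integral \<beta> (ml_solution \<alpha> m \<alpha> c0 c1 f) t"
      using that by (intro rl_integral_cong u) auto
    also have "\<dots> = ml_solution \<alpha> m (\<beta> + \<alpha>) c0 c1 f t"
      using that \<alpha> by (intro rl_integral_ml_solution[OF _ _ _ f]) auto
    finally show ?thesis .
  qed
  define G where "G = (\<lambda>k::nat. if k = 0 then ml_solution \<alpha> m 2 c0 c1 f
      else if k = 1 then ml_solution \<alpha> m 1 c0 c1 f else (\<lambda>t. f t + m *\<^sub>R ml_solution \<alpha> m \<alpha> c0 c1 f t))"
  have G: "(G k has_vector_derivative G (Suc k) t) (at t within {0<..<T})"
    if "k < 2" "t \<in> {0<..<T}" for k t
  proof (rule has_vector_derivative_within_subset)
    have "k = 0 \<or> k = 1" using that by auto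
    then show "(G k has_vector_derivative G (Suc k) t) (at t within {0<..T})"
      using ml_solution_has_vector_derivative[OF _ _ f, of \<alpha> 2 t m c0 c1]
        ml_solution_1_has_vector_derivative[OF _ f, of \<alpha> t m c0 c1] \<alpha> that
      by (auto simp: G_def)
  qed (use that in auto)
  have F: "rl_integral (2 - \<alpha>) u t = G 0 t" if "t \<in> {0<..<T}" for t
    using int[of "2 - \<alpha>" t] that \<alpha> by (simp add: G_def)
  note chain = nth_vderiv_chain[of 2 "{0<..<T}" G, OF G at_within_Ioo_neq_bot F]
  show "rl_differentiable_on \<alpha> u {0<..<T}"
    unfolding rl_differentiable_on_def using chain(1) \<alpha> by (simp add: rl_order_eq_2)
  show "rl_deriv \<alpha> u t = f t + m *\<^sub>R u t" if "t \<in> {0<..<T}" for t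
  proof -
    have "rl_deriv \<alpha> u t = nth_vderiv UNIV 2 (rl_integral (2 - \<alpha>) u) t"
      using \<alpha> by (simp add: rl_deriv_def rl_order_eq_2)
    also have "\<dots> = G 2 t"
      using that chain(2)[of 2 t] by (subst nth_vderiv_open[of "{0<..<T}"]) auto
    finally show ?thesis
      using u[of t] that by (simp add: G_def)
  qed
  fix \<gamma> :: real assume \<gamma>: "0 < \<gamma>" "\<gamma> \<le> \<alpha> - 1"
  define H where "H = (\<lambda>k::nat. if k = 0 then ml_solution \<alpha> m (1 - \<gamma> + \<alpha>) c0 c1 f
      else ml_solution \<alpha> m (\<alpha> - \<gamma>) c0 c1 f)"
  have H: "(H k has_vector_derivative H (Suc k) t) (at t within {0<..<T})"
    if "k < 1" "t \<in> {0<..<T}" for k t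
  proof (rule has_vector_derivative_within_subset)
    have "1 - \<gamma> + \<alpha> - 1 = \<alpha> - \<gamma>" by simp
    then show "(H k has_vector_derivative H (Suc k) t) (at t within {0<..T})"
      using ml_solution_has_vector_derivative[OF _ _ f, of \<alpha> "1 - \<gamma> + \<alpha>" t m c0 c1] \<alpha> \<gamma> that
      by (auto simp: H_def)
  qed (use that in auto)
  have F: "rl_integral (1 - \<gamma>) u t = H 0 t" if "t \<in> {0<..<T}" for t
    using int[of "1 - \<gamma>" t] that \<alpha> \<gamma> by (simp add: H_def)
  note chain = nth_vderiv_chain[of 1 "{0<..<T}" H, OF H at_within_Ioo_neq_bot F]
  show "rl_differentiable_on \<gamma> u {0<..<T}"
    unfolding rl_differentiable_on_def using chain(1) \<alpha> \<gamma> by (simp add: rl_order_eq_1)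
  show "rl_deriv \<gamma> u t = ml_solution \<alpha> m (\<alpha> - \<gamma>) c0 c1 f t" if "t \<in> {0<..<T}" for t
  proof -
    have "rl_deriv \<gamma> u t = nth_vderiv UNIV 1 (rl_integral (1 - \<gamma>) u) t"
      using \<alpha> \<gamma> by (simp add: rl_deriv_def rl_order_eq_1)
    also have "\<dots> = H 1 t"
      using that chain(2)[of 1 t] by (subst nth_vderiv_open[of "{0<..<T}"]) auto
    finally show ?thesis
      by (simp add: H_def)
  qed
qed

section \<open>Representation and regularity of solutions\<close>

lemma zero_vector_derivative_constant:
  fixes g :: "real \<Rightarrow> 'a::real_normed_vector"
  assumes "convex S" "\<And>x. x \<in> S \<Longrightarrow> (g has_vector_derivative 0) (at x within S)"
  shows "\<exists>c. \<forall>x\<in>S. g x = c"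
  using has_derivative_zero_constant[of S g] assms by (auto simp: has_vector_derivative_def)

lemma conv_ml_kernel_rl_kernel_scaleR:
  assumes "\<alpha> > 0" "\<beta> > 0" "\<delta> > 0" "0 < t"
  shows "conv (ml_kernel \<alpha> m \<delta>) (\<lambda>s. rl_kernel \<beta> s *\<^sub>R c) t = ml_kernel \<alpha> m (\<beta> + \<delta>) t *\<^sub>R c"
proof -
  have "conv (ml_kernel \<alpha> m \<delta>) (\<lambda>s. rl_kernel \<beta> s *\<^sub>R c) t =
      conv (ml_kernel \<alpha> m \<delta>) (rl_kernel \<beta>) t *\<^sub>R c"
    by (rule conv_scaleR_const[OF weighted_cont_ml_kernel weighted_cont_rl_kernel])
       (use assms in auto)
  also have "conv (ml_kernel \<alpha> m \<delta>) (rl_kernel \<beta>) t = ml_kernel \<alpha> m (\<beta> + \<delta>) t"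
    using conv_rl_kernel_ml_kernel[OF assms] conv_commute_real[of "ml_kernel \<alpha> m \<delta>" "rl_kernel \<beta>" t]
    by simp
  finally show ?thesis .
qed

lemma rl_solution_representation:
  fixes f u :: "real \<Rightarrow> 'a::euclidean_space"
  assumes \<alpha>: "1 < \<alpha>" "\<alpha> \<le> 2" and u: "weighted_cont p T u" "p > -1"
    and f: "weighted_cont q T f" "q > -1"
    and diff: "rl_differentiable_on \<alpha> u {0<..<T}"
    and eq: "\<And>t. t \<in> {0<..<T} \<Longrightarrow> rl_deriv \<alpha> u t = f t + m *\<^sub>R u t"
  obtains c0 c1 where "\<And>t. t \<in> {0<..T} \<Longrightarrow> u t = ml_solution \<alpha> m \<alpha> c0 c1 f t"
proof -
  define S where "S = {0<..<T}"
  \<comment> \<open>A common exponent for f and u, hence one for f + m u.\<close>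
  define r where "r = min p q"
  define h where "h = (\<lambda>t. f t + m *\<^sub>R u t)"
  define v where "v = rl_integral (2 - \<alpha>) u"
  define v' where "v' = nth_vderiv S 1 v"
  define H1 where "H1 = conv (rl_kernel 1) h"
  define H2 where "H2 = conv (rl_kernel 1) H1"
  have S: "open S" "convex S" "S \<subseteq> {0<..T}" by (auto simp: S_def)
  have r: "r > -1" "weighted_cont r T u" "weighted_cont r T f"
    using u f by (auto simp: r_def intro: weighted_cont_mono)
  have h: "weighted_cont r T h"
    unfolding h_def by (intro weighted_cont_add weighted_cont_scaleR r)
  have H1: "weighted_cont (r + 1) T H1"
    using weighted_cont_conv[OF weighted_cont_rl_kernel[of 1] h] r by (simp add: H1_def)
  have chain: "times_differentiable_on 2 v S"
    using diff \<alpha> by (simp add: rl_differentiable_on_def rl_order_eq_2 v_def S_def)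
  have v: "(v has_vector_derivative v' t) (at t within S)" if "t \<in> S" for t
    using times_differentiable_on_has_vector_derivative[OF chain, of 0 t] that by (simp add: v'_def)
  have v': "(v' has_vector_derivative h t) (at t within S)" if "t \<in> S" for t
  proof -
    have "nth_vderiv S 2 v t = rl_deriv \<alpha> u t"
      using nth_vderiv_open[OF S(1) that, of 2 v] \<alpha> by (simp add: rl_deriv_def rl_order_eq_2 v_def)
    then show ?thesis
      using times_differentiable_on_has_vector_derivative[OF chain, of 1 t] that eq[of t]
      by (simp add: v'_def h_def S_def numeral_2_eq_2)
  qed
  have H1': "(H1 has_vector_derivative h t) (at t within S)" if "t \<in> S" for t
    unfolding H1_def
    by (rule has_vector_derivative_within_subset[OF conv_rl_kernel_1_has_vector_derivative[OF h r(1)] S(3)])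
       (use that S in auto)
  have H2': "(H2 has_vector_derivative H1 t) (at t within S)" if "t \<in> S" for t
    unfolding H2_def
    by (rule has_vector_derivative_within_subset[OF conv_rl_kernel_1_has_vector_derivative[OF H1] S(3)])
       (use that S r in auto)
  \<comment> \<open>Integration constants replace initial values: as \<open>H1\<close> and
    \<open>H2\<close> tend to 0 at 0, the constants \<open>c1\<close> and \<open>c0\<close> are the
    limits of \<open>v'\<close> and \<open>v\<close> there.\<close>
  have "\<exists>c. \<forall>t\<in>S. v' t - H1 t = c"
    using has_vector_derivative_diff[OF v' H1'] by (intro zero_vector_derivative_constant S) auto
  then obtain c1 where c1: "v' t - H1 t = c1" if "t \<in> S" for t
    by blast
  have "((\<lambda>t. v t - H2 t - t *\<^sub>R c1) has_vector_derivative 0) (at t within S)" if "t \<in> S" for t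
  proof -
    have "((\<lambda>t. v t - H2 t - t *\<^sub>R c1) has_vector_derivative v' t - H1 t - 1 *\<^sub>R c1) (at t within S)"
      by (intro has_vector_derivative_diff v H2' that)
         (auto intro!: derivative_eq_intros simp: has_vector_derivative_def)
    then show ?thesis using c1[OF that] by simp
  qed
  from zero_vector_derivative_constant[OF S(2) this]
  obtain c0 where c0: "v t - H2 t - t *\<^sub>R c1 = c0" if "t \<in> S" for t
    by blast
  \<comment> \<open>Writing 1 and t as \<open>rl_kernel 1\<close> and \<open>rl_kernel 2\<close>
    makes convolution with the Mittag-Leffler kernel a mere index shift.\<close>
  have v_eq: "v t = (rl_kernel 1 t *\<^sub>R c0 + rl_kernel 2 t *\<^sub>R c1) + H2 t" if "t \<in> S" for t
    using c0[OF that, symmetric] that by (simp add: rl_kernel_1 rl_kernel_2 S_def)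
  have I2u: "conv (rl_kernel 2) u t = ml_solution \<alpha> m (\<alpha> + 2) c0 c1 f t" if t: "t \<in> S" for t
  proof -
    have tT: "0 < t" "t \<le> T" using t by (auto simp: S_def)
    let ?K = "ml_kernel \<alpha> m"
    have K: "weighted_cont (\<alpha> - 1) T (?K \<alpha>)"
      using \<alpha> by (intro weighted_cont_ml_kernel) auto
    have "conv (?K \<alpha>) v t = conv (?K 2) u t"
    \<comment> \<open>For \<alpha> = 2, \<open>v\<close> is u itself, since
      \<open>rl_integral 0\<close> is the identity and has no kernel.\<close>
    proof (cases "\<alpha> = 2")
      case True
      then have "v = u" by (simp add: v_def rl_integral_def fun_eq_iff)
      then show ?thesis using True by simp
    next
      case False
      then have "v = conv (rl_kernel (2 - \<alpha>)) u"
        using \<alpha> by (simp add: v_def fun_eq_iff rl_integral_eq_conv)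
      then show ?thesis
        using conv_rl_kernel_conv_ml_kernel(2)[of \<alpha> "2 - \<alpha>" \<alpha> p T u t m] False \<alpha> u tT by simp
    qed
    \<comment> \<open>The term with factor m reappears in the evaluation through
      \<open>v_eq\<close>, where u enters as part of \<open>h\<close>; the two cancel at the end of
      this block.\<close>
    also have "conv (?K 2) u t = conv (rl_kernel 2) u t + m *\<^sub>R conv (?K (2 + \<alpha>)) u t"
      by (rule conv_ml_kernel_shift[OF _ _ u tT(2)]) (use \<alpha> in auto)
    finally have lhs: "conv (?K \<alpha>) v t = conv (rl_kernel 2) u t + m *\<^sub>R conv (?K (\<alpha> + 2)) u t"
      by (simp add: add.commute)
    have w1: "weighted_cont 0 T (\<lambda>s. rl_kernel 1 s *\<^sub>R c0)"
      using weighted_cont_scaleR_left[OF weighted_cont_rl_kernel[of 1]] by simp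
    have w2: "weighted_cont 0 T (\<lambda>s. rl_kernel 2 s *\<^sub>R c1)"
      using weighted_cont_mono[OF weighted_cont_scaleR_left[OF weighted_cont_rl_kernel[of 2]], of 0] by simp
    have w3: "weighted_cont (r + 2) T H2"
      using weighted_cont_conv[OF weighted_cont_rl_kernel[of 1] H1] r by (simp add: H2_def add.assoc)
    have "conv (?K \<alpha>) v t = conv (?K \<alpha>) (\<lambda>s. (rl_kernel 1 s *\<^sub>R c0 + rl_kernel 2 s *\<^sub>R c1) + H2 s) t"
      using v_eq tT t by (intro conv_cong) (auto simp: S_def)
    also have "\<dots> = conv (?K \<alpha>) (\<lambda>s. rl_kernel 1 s *\<^sub>R c0 + rl_kernel 2 s *\<^sub>R c1) t + conv (?K \<alpha>) H2 t"
      by (rule conv_add_right[OF K weighted_cont_add[OF w1 w2] w3]) (use \<alpha> r tT in auto)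
    also have "conv (?K \<alpha>) (\<lambda>s. rl_kernel 1 s *\<^sub>R c0 + rl_kernel 2 s *\<^sub>R c1) t =
        conv (?K \<alpha>) (\<lambda>s. rl_kernel 1 s *\<^sub>R c0) t + conv (?K \<alpha>) (\<lambda>s. rl_kernel 2 s *\<^sub>R c1) t"
      by (rule conv_add_right[OF K w1 w2]) (use \<alpha> r tT in auto)
    also have "conv (?K \<alpha>) (\<lambda>s. rl_kernel 1 s *\<^sub>R c0) t = ?K (1 + \<alpha>) t *\<^sub>R c0"
      using \<alpha> tT by (intro conv_ml_kernel_rl_kernel_scaleR) auto
    also have "conv (?K \<alpha>) (\<lambda>s. rl_kernel 2 s *\<^sub>R c1) t = ?K (2 + \<alpha>) t *\<^sub>R c1"
      using \<alpha> tT by (intro conv_ml_kernel_rl_kernel_scaleR) auto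
    also have "conv (?K \<alpha>) H2 t = conv (?K (1 + \<alpha>)) H1 t"
      unfolding H2_def using \<alpha> r tT by (intro conv_rl_kernel_conv_ml_kernel(2)[OF _ _ _ H1]) auto
    also have "\<dots> = conv (?K (1 + (1 + \<alpha>))) h t"
      unfolding H1_def using \<alpha> r tT by (intro conv_rl_kernel_conv_ml_kernel(2)[OF _ _ _ h]) auto
    also have "1 + (1 + \<alpha>) = \<alpha> + 2" by simp
    also have "conv (?K (\<alpha> + 2)) h t = conv (?K (\<alpha> + 2)) f t + conv (?K (\<alpha> + 2)) (\<lambda>s. m *\<^sub>R u s) t"
      unfolding h_def
      by (rule conv_add_right[OF weighted_cont_ml_kernel r(3) weighted_cont_scaleR[OF r(2)]])
         (use \<alpha> r tT in auto)
    finally show ?thesis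
      using lhs by (simp add: ml_solution_def conv_scaleR_right add_ac)
  qed
  \<comment> \<open>Both sides of \<open>I2u\<close> are differentiated, the left one as the case m
    = 0 of the kernel lemma. Uniqueness of derivatives gives this identity, and a second round gives
    u.\<close>
  have Iu: "conv (rl_kernel 1) u t = ml_solution \<alpha> m (\<alpha> + 1) c0 c1 f t" if "t \<in> S" for t
  proof (rule vector_derivative_unique_within)
    show "at t within S \<noteq> bot"
      using that by (simp add: S_def at_within_Ioo_neq_bot)
    show "(conv (rl_kernel 2) u has_vector_derivative conv (rl_kernel 1) u t) (at t within S)"
      by (rule has_vector_derivative_within_subset[OF _ S(3)])
         (use conv_ml_kernel_has_vector_derivative[OF _ _ u, of \<alpha> 2 t 0] that \<alpha> S in
            \<open>auto simp: ml_kernel_0\<close>)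
    show "(conv (rl_kernel 2) u has_vector_derivative ml_solution \<alpha> m (\<alpha> + 1) c0 c1 f t) (at t within S)"
      by (rule has_vector_derivative_transform[OF that I2u has_vector_derivative_within_subset[OF _ S(3)]])
         (use ml_solution_has_vector_derivative[OF _ _ f, of \<alpha> "\<alpha> + 2" t m c0 c1] that \<alpha> S in
            \<open>auto simp: add.commute\<close>)
  qed
  have u_eq: "u t = ml_solution \<alpha> m \<alpha> c0 c1 f t" if "t \<in> S" for t
  proof (rule vector_derivative_unique_within)
    show "at t within S \<noteq> bot"
      using that by (simp add: S_def at_within_Ioo_neq_bot)
    show "(conv (rl_kernel 1) u has_vector_derivative u t) (at t within S)"
      by (rule has_vector_derivative_within_subset[OF conv_rl_kernel_1_has_vector_derivative[OF u] S(3)])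
         (use that S in auto)
    show "(conv (rl_kernel 1) u has_vector_derivative ml_solution \<alpha> m \<alpha> c0 c1 f t) (at t within S)"
      by (rule has_vector_derivative_transform[OF that Iu has_vector_derivative_within_subset[OF _ S(3)]])
         (use ml_solution_has_vector_derivative[OF _ _ f, of \<alpha> "\<alpha> + 1" t m c0 c1] that \<alpha> S in auto)
  qed
  \<comment> \<open>The equation is only imposed for t < T; continuity on \<open>{0<..T}\<close>
    extends the formula to T. Starting at T/2 keeps the closure away from the singularity at
    0.\<close>
  have end_eq: "u T = ml_solution \<alpha> m \<alpha> c0 c1 f T" if "T > 0"
  proof -
    have "continuous_on {0<..T} (\<lambda>t. u t - ml_solution \<alpha> m \<alpha> c0 c1 f t)"
      using \<alpha> by (intro continuous_on_diff weighted_cont_imp_continuous_on[OF u(1)]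
          weighted_cont_imp_continuous_on[OF weighted_cont_ml_solution[OF _ _ f]]) auto
    then have "continuous_on (closure {T/2<..<T}) (\<lambda>t. u t - ml_solution \<alpha> m \<alpha> c0 c1 f t)"
      by (rule continuous_on_subset) (use that in \<open>auto simp: closure_greaterThanLessThan\<close>)
    then have "u T - ml_solution \<alpha> m \<alpha> c0 c1 f T = 0"
      by (rule continuous_constant_on_closure)
         (use that u_eq in \<open>auto simp: closure_greaterThanLessThan S_def\<close>)
    then show ?thesis by simp
  qed
  show thesis
  proof (rule that)
    fix t assume "t \<in> {0<..T}"
    then show "u t = ml_solution \<alpha> m \<alpha> c0 c1 f t"
      using u_eq[of t] end_eq by (cases "t = T") (auto simp: S_def)
  qed
qed

section \<open>Regularity at 0\<close>

text \<open>The derivative is integrable at 0 because q > -1, so f minus its primitive is constant.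
  The constant \<open>F0\<close> is the limit of f at 0.\<close>

lemma C1_representation:
  fixes f :: "real \<Rightarrow> 'a::euclidean_space"
  assumes "times_differentiable_on 1 f {0<..T}" "weighted_cont q T (nth_vderiv {0<..T} 1 f)" "q > -1"
  obtains F0 where "\<And>t. t \<in> {0<..T} \<Longrightarrow> f t = F0 + conv (rl_kernel 1) (nth_vderiv {0<..T} 1 f) t"
proof -
  let ?g = "nth_vderiv {0<..T} 1 f"
  have "((\<lambda>t. f t - conv (rl_kernel 1) ?g t) has_vector_derivative ?g t - ?g t) (at t within {0<..T})"
    if "t \<in> {0<..T}" for t
    using times_differentiable_on_has_vector_derivative[OF assms(1), of 0 t] that
    by (intro has_vector_derivative_diff conv_rl_kernel_1_has_vector_derivative[OF assms(2,3)]) auto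
  then have "\<exists>c. \<forall>t\<in>{0<..T}. f t - conv (rl_kernel 1) ?g t = c"
    by (intro zero_vector_derivative_constant) (auto simp only: diff_self convex_real_interval)
  then obtain F0 where "f t - conv (rl_kernel 1) ?g t = F0" if "t \<in> {0<..T}" for t
    by blast
  then show thesis
    by (intro that[of F0]) (simp add: diff_eq_eq)
qed

lemma C_minus_one_k_chain:
  assumes "\<And>k x. k < n \<Longrightarrow> x \<in> {0<..T} \<Longrightarrow>
      (G k has_vector_derivative G (Suc k) x) (at x within {0<..T})"
    and "\<And>x. x \<in> {0<..T} \<Longrightarrow> F x = G 0 x"
    and "weighted_cont p T (G n)" "p > -1"
  shows "C_minus_one_k n T F"
proof -
  note chain = nth_vderiv_chain[of n "{0<..T}" G F, OF assms(1) at_within_Ioc_neq_bot assms(2)]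
  have "weighted_cont p T (nth_vderiv {0<..T} n F)"
    using assms(3) chain(2)[of n] by (subst weighted_cont_cong[where g = "G n"]) auto
  then show ?thesis
    using chain(1) assms(4) by (auto simp: C_minus_one_k_def C_minus_one_iff)
qed

lemma powr_scaleR_has_vector_derivative:
  assumes "(U has_vector_derivative U') (at t within A)" "t > 0"
  shows "((\<lambda>t. t powr s *\<^sub>R U t) has_vector_derivative t powr s *\<^sub>R U' + (s * t powr (s - 1)) *\<^sub>R U t)
           (at t within A)"
proof -
  have "((\<lambda>t. t powr s) has_real_derivative s * t powr (s - 1)) (at t within A)"
    using assms(2) by (auto intro!: derivative_eq_intros)
  from has_vector_derivative_scaleR[OF this assms(1)] show ?thesis by simp
qed

text \<open>Representing f as \<open>F0\<close> plus the primitive of g raises the index of the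
  convolution from \<alpha> to \<alpha> + 1. Two derivatives then end at \<alpha> - 1 > 0, still a
  convolvable kernel.\<close>

lemma ml_solution_regularity:
  fixes f g u :: "real \<Rightarrow> complex"
  assumes \<alpha>: "1 < \<alpha>" and g: "weighted_cont q T g" "q > -1"
    and f: "\<And>t. t \<in> {0<..T} \<Longrightarrow> f t = F0 + conv (rl_kernel 1) g t"
    and u: "\<And>t. t \<in> {0<..T} \<Longrightarrow> u t = ml_solution \<alpha> m \<alpha> c0 c1 f t"
  shows "C_minus_one_k 2 T (\<lambda>t. t powr (2 - \<alpha>) *\<^sub>R u t)"
proof -
  let ?K = "ml_kernel \<alpha> m"
  \<comment> \<open>The leading terms \<open>t powr (\<alpha> - 2)\<close> and \<open>t powr (\<alpha> - 1)\<close> of the kernels become affine after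
    multiplication with \<open>t powr (2 - \<alpha>)\<close>; \<open>U 0\<close> is the rest of \<open>u\<close>, and \<open>U k\<close> its derivatives.\<close>
  define U where "U = (\<lambda>(k::nat) t. ?K (2 * \<alpha> - 1 - real k) t *\<^sub>R (m *\<^sub>R c0) +
      ?K (2 * \<alpha> - real k) t *\<^sub>R (m *\<^sub>R c1) + ?K (\<alpha> + 1 - real k) t *\<^sub>R F0 +
      conv (?K (\<alpha> + 1 - real k)) g t)"
  have U': "(U k has_vector_derivative U (Suc k) t) (at t within {0<..T})"
    if "k < 2" "t \<in> {0<..T}" for k t
  proof -
    have "real (Suc k) = real k + 1" by simp
    then show ?thesis
      unfolding U_def diff_diff_eq[symmetric]
      by (simp only: diff_diff_eq[symmetric])
         (intro has_vector_derivative_add ml_kernel_scaleR_has_vector_derivative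
           conv_ml_kernel_has_vector_derivative[OF _ _ g], use that \<alpha> in auto)
  qed
  \<comment> \<open>Every term of \<open>U k\<close> has exponent at least r - k. In
    \<open>G 2\<close>, \<open>U k\<close> is multiplied by \<open>t powr (k - \<alpha>)\<close>, so
    all terms get the exponent r - \<alpha>, which exceeds -1 because \<alpha> > 1 and q >
    -1.\<close>
  define r where "r = min (2 * \<alpha> - 2) (\<alpha> + min q 0)"
  have r: "r > \<alpha> - 1" "r \<le> 2 * \<alpha> - 2" "r \<le> \<alpha> + q" "r \<le> \<alpha>"
    using \<alpha> g by (auto simp: r_def)
  have K: "weighted_cont s T (\<lambda>t. ?K \<delta> t *\<^sub>R c)" if "s \<le> \<delta> - 1" for \<delta> s and c :: complex
    using \<alpha> that
    by (intro weighted_cont_mono[OF weighted_cont_scaleR_left[OF weighted_cont_ml_kernel]]) auto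
  have wU: "weighted_cont (r - real k) T (U k)" if "k \<le> 2" for k
    unfolding U_def
  proof (intro weighted_cont_add K)
    show "weighted_cont (r - real k) T (conv (?K (\<alpha> + 1 - real k)) g)"
      by (rule weighted_cont_mono[OF weighted_cont_conv_ml_kernel[OF _ _ g]]) (use \<alpha> r that in auto)
  qed (use \<alpha> r in auto)
  define G where "G = (\<lambda>k::nat.
      if k = 0 then (\<lambda>t. rGamma (\<alpha> - 1) *\<^sub>R c0 + t *\<^sub>R (rGamma \<alpha> *\<^sub>R c1) + t powr (2 - \<alpha>) *\<^sub>R U 0 t)
      else if k = 1 then (\<lambda>t. rGamma \<alpha> *\<^sub>R c1 + (t powr (2 - \<alpha>) *\<^sub>R U 1 t + (2 - \<alpha>) *\<^sub>R t powr (1 - \<alpha>) *\<^sub>R U 0 t))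
      else (\<lambda>t. t powr (2 - \<alpha>) *\<^sub>R U 2 t + (2 * (2 - \<alpha>)) *\<^sub>R t powr (1 - \<alpha>) *\<^sub>R U 1 t +
         ((2 - \<alpha>) * (1 - \<alpha>)) *\<^sub>R t powr (- \<alpha>) *\<^sub>R U 0 t))"
  show ?thesis
  proof (rule C_minus_one_k_chain[where G = G and p = "r - \<alpha>"])
    fix k :: nat and t assume k: "k < 2" and t: "t \<in> {0<..T}"
    have P: "((\<lambda>t. t powr s *\<^sub>R U j t) has_vector_derivative
        t powr s *\<^sub>R U (Suc j) t + (s * t powr (s - 1)) *\<^sub>R U j t) (at t within {0<..T})" if "j < 2" for s j
      using t that by (intro powr_scaleR_has_vector_derivative U') auto
    \<comment> \<open>Merges the two equal cross terms of the product rule, whence the factor 2 in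
      \<open>G 2\<close>.\<close>
    have comb: "0 + ((x + (s * p) *\<^sub>R y) + s *\<^sub>R (p *\<^sub>R y + (r * q) *\<^sub>R z)) =
        x + (2 * s) *\<^sub>R p *\<^sub>R y + (s * r) *\<^sub>R q *\<^sub>R z" for x y z :: complex and s p q r :: real
      unfolding mult_2 scaleR_scaleR distrib_right scaleR_add_left scaleR_add_right
      by (simp only: add_0_left add.assoc mult.assoc)
    have exps: "2 - \<alpha> - 1 = 1 - \<alpha>" "1 - \<alpha> - 1 = - \<alpha>" "Suc 1 = 2" "Suc 0 = 1"
      by simp_all
    have "k = 0 \<or> k = 1" using k by auto
    then show "(G k has_vector_derivative G (Suc k) t) (at t within {0<..T})"
    proof
      assume [simp]: "k = 0"
      have "((\<lambda>t. rGamma (\<alpha> - 1) *\<^sub>R c0 + t *\<^sub>R (rGamma \<alpha> *\<^sub>R c1) + t powr (2 - \<alpha>) *\<^sub>R U 0 t)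
          has_vector_derivative 0 + 1 *\<^sub>R (rGamma \<alpha> *\<^sub>R c1) +
            (t powr (2 - \<alpha>) *\<^sub>R U (Suc 0) t + ((2 - \<alpha>) * t powr (2 - \<alpha> - 1)) *\<^sub>R U 0 t)) (at t within {0<..T})"
        by (intro has_vector_derivative_add P)
           (auto intro!: derivative_eq_intros simp: has_vector_derivative_def)
      then show ?thesis
        by (simp add: G_def)
    next
      assume [simp]: "k = 1"
      have "((\<lambda>t. rGamma \<alpha> *\<^sub>R c1 + (t powr (2 - \<alpha>) *\<^sub>R U 1 t + (2 - \<alpha>) *\<^sub>R t powr (1 - \<alpha>) *\<^sub>R U 0 t))
          has_vector_derivative 0 +
            ((t powr (2 - \<alpha>) *\<^sub>R U (Suc 1) t + ((2 - \<alpha>) * t powr (2 - \<alpha> - 1)) *\<^sub>R U 1 t) +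
            (2 - \<alpha>) *\<^sub>R (t powr (1 - \<alpha>) *\<^sub>R U (Suc 0) t + ((1 - \<alpha>) * t powr (1 - \<alpha> - 1)) *\<^sub>R U 0 t)))
          (at t within {0<..T})"
        by (intro has_vector_derivative_add has_vector_derivative_const P
              bounded_linear.has_vector_derivative[OF bounded_linear_scaleR_right]) auto
      then have "((\<lambda>t. rGamma \<alpha> *\<^sub>R c1 + (t powr (2 - \<alpha>) *\<^sub>R U 1 t + (2 - \<alpha>) *\<^sub>R t powr (1 - \<alpha>) *\<^sub>R U 0 t))
          has_vector_derivative t powr (2 - \<alpha>) *\<^sub>R U 2 t + (2 * (2 - \<alpha>)) *\<^sub>R t powr (1 - \<alpha>) *\<^sub>R U 1 t +
            ((2 - \<alpha>) * (1 - \<alpha>)) *\<^sub>R t powr (- \<alpha>) *\<^sub>R U 0 t) (at t within {0<..T})"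
        unfolding exps comb .
      then show ?thesis
        by (simp add: G_def)
    qed
  next
    fix t assume t: "t \<in> {0<..T}"
    have K1: "?K \<alpha> t = rl_kernel \<alpha> t + m * ?K (2 * \<alpha>) t"
      "?K (\<alpha> - 1) t = rl_kernel (\<alpha> - 1) t + m * ?K (2 * \<alpha> - 1) t"
      using ml_kernel_shift[of \<alpha> t m \<alpha>] ml_kernel_shift[of \<alpha> t m "\<alpha> - 1"] \<alpha> t
      by (simp_all add: algebra_simps)
    have "conv (?K \<alpha>) f t = conv (?K \<alpha>) (\<lambda>s. rl_kernel 1 s *\<^sub>R F0 + conv (rl_kernel 1) g s) t"
      using f t by (intro conv_cong) (auto simp: rl_kernel_1)
    also have "\<dots> = conv (?K \<alpha>) (\<lambda>s. rl_kernel 1 s *\<^sub>R F0) t + conv (?K \<alpha>) (conv (rl_kernel 1) g) t"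
      by (rule conv_add_right[OF weighted_cont_ml_kernel
            weighted_cont_scaleR_left[OF weighted_cont_rl_kernel]
            weighted_cont_conv[OF weighted_cont_rl_kernel g(1)]]) (use \<alpha> g t in auto)
    also have "\<dots> = ?K (1 + \<alpha>) t *\<^sub>R F0 + conv (?K (1 + \<alpha>)) g t"
      using conv_ml_kernel_rl_kernel_scaleR[of \<alpha> 1 \<alpha> t m F0]
        conv_rl_kernel_conv_ml_kernel(2)[of \<alpha> 1 \<alpha> q T g t m] \<alpha> g t by simp
    finally have "u t = rl_kernel (\<alpha> - 1) t *\<^sub>R c0 + rl_kernel \<alpha> t *\<^sub>R c1 + U 0 t"
      using u[OF t] by (simp add: ml_solution_def U_def K1 algebra_simps)
    moreover have "t powr (2 - \<alpha>) * t powr (\<alpha> - 2) = 1" "t powr (2 - \<alpha>) * t powr (\<alpha> - 1) = t"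
      using t by (simp_all flip: powr_add)
    ultimately show "t powr (2 - \<alpha>) *\<^sub>R u t = G 0 t"
      by (simp add: G_def rl_kernel_def scaleR_add_right mult.left_commute[of "t powr (2 - \<alpha>)"])
  next
    have W: "weighted_cont (r - \<alpha>) T (\<lambda>t. t powr s *\<^sub>R U j t)" if "j \<le> 2" "s = real j - \<alpha>" for s j
      using weighted_cont_powr_scaleR[OF wU[OF that(1)], of s] that by simp
    have G2: "G 2 = (\<lambda>t. t powr (2 - \<alpha>) *\<^sub>R U 2 t + (2 * (2 - \<alpha>)) *\<^sub>R t powr (1 - \<alpha>) *\<^sub>R U 1 t +
        ((2 - \<alpha>) * (1 - \<alpha>)) *\<^sub>R t powr (- \<alpha>) *\<^sub>R U 0 t)"
      by (simp add: G_def)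
    show "weighted_cont (r - \<alpha>) T (G 2)"
      unfolding G2 by (intro weighted_cont_add weighted_cont_scaleR W) auto
    show "r - \<alpha> > -1" using r by simp
  qed
qed

text \<open>For \<alpha> = 2 the equation itself gives u'' = f + m u, which inherits the class of
  f.\<close>

lemma ml_solution_regularity_2:
  fixes f u :: "real \<Rightarrow> complex"
  assumes f: "weighted_cont q T f" "q > -1"
    and u: "\<And>t. t \<in> {0<..T} \<Longrightarrow> u t = ml_solution 2 m 2 c0 c1 f t"
  shows "C_minus_one_k 2 T u"
proof (rule C_minus_one_k_chain)
  define G where "G = (\<lambda>k::nat. if k = 0 then ml_solution 2 m 2 c0 c1 f
      else if k = 1 then ml_solution 2 m 1 c0 c1 f else (\<lambda>t. f t + m *\<^sub>R ml_solution 2 m 2 c0 c1 f t))"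
  show "(G k has_vector_derivative G (Suc k) t) (at t within {0<..T})" if "k < 2" "t \<in> {0<..T}" for k t
  proof -
    have "k = 0 \<or> k = 1" using that by auto
    then show ?thesis
      using ml_solution_has_vector_derivative[OF _ _ f, of 2 2 t m c0 c1]
        ml_solution_1_has_vector_derivative[OF _ f, of 2 t m c0 c1] that
      by (auto simp: G_def)
  qed
  show "u t = G 0 t" if "t \<in> {0<..T}" for t
    using u that by (simp add: G_def)
  have "weighted_cont 0 T (ml_solution 2 m 2 c0 c1 f)"
    using weighted_cont_ml_solution[OF _ _ f, of 2 2] by simp
  then show "weighted_cont (min q 0) T (G 2)"
    unfolding G_def
    by (auto intro!: weighted_cont_add weighted_cont_scaleR intro: weighted_cont_mono f)
  show "min q 0 > -1" using f by simp
qed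

section \<open>The non-local conditions\<close>

context
  fixes T m a \<alpha> \<beta> \<gamma> :: real
  assumes a: "0 < a" "a < T" and \<alpha>: "1 < \<alpha>" "\<alpha> \<le> 2"
    and \<beta>: "0 \<le> \<beta>" and \<gamma>: "0 < \<gamma>" "\<gamma> \<le> \<alpha> - 1"
    and Delta: "Delta m a \<alpha> \<beta> \<gamma> \<noteq> 0"
begin

private abbreviation K :: "real \<Rightarrow> real" where "K \<sigma> \<equiv> ml_kernel \<alpha> m \<sigma> a"

text \<open>The determinant of the system for the two constants with reversed sign, which makes it a
  positive multiple of \<open>Delta\<close>.\<close>

private definition D :: real where
  "D = K (\<beta> + \<alpha>) * K (\<alpha> - \<gamma> - 1) - K (\<beta> + \<alpha> - 1) * K (\<alpha> - \<gamma>)"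

private lemma powr_pred: "t > 0 \<Longrightarrow> t powr s = t powr (s - 1) * t" for s t :: real
  using powr_add[of t "s - 1" 1] by simp

text \<open>Exponents are normalised so that the two kernels of each condition share one power of a;
  these powers then come out of the determinant.\<close>

private lemma kernels_at_a:
  "K (\<beta> + \<alpha> - 1) = a powr (\<alpha> + \<beta> - 2) * mittag_leffler \<alpha> (\<alpha> - 1 + \<beta>) (m * a powr \<alpha>)"
  "K (\<beta> + \<alpha>) = a powr (\<alpha> + \<beta> - 2) * a * mittag_leffler \<alpha> (\<alpha> + \<beta>) (m * a powr \<alpha>)"
  "K (\<alpha> - \<gamma> - 1) = a powr (\<alpha> - \<gamma> - 2) * mittag_leffler \<alpha> (\<alpha> - 1 - \<gamma>) (m * a powr \<alpha>)"
  "K (\<alpha> - \<gamma>) = a powr (\<alpha> - \<gamma> - 2) * a * mittag_leffler \<alpha> (\<alpha> - \<gamma>) (m * a powr \<alpha>)"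
proof -
  have "\<beta> + \<alpha> - 1 = \<alpha> - 1 + \<beta>" "\<alpha> - 1 + \<beta> - 1 = \<alpha> + \<beta> - 2" "\<beta> + \<alpha> = \<alpha> + \<beta>" "\<alpha> + \<beta> - 1 - 1 = \<alpha> + \<beta> - 2"
      "\<alpha> - \<gamma> - 1 - 1 = \<alpha> - \<gamma> - 2" "\<alpha> - \<gamma> - 1 = \<alpha> - 1 - \<gamma>" "\<alpha> - 1 - \<gamma> - 1 = \<alpha> - \<gamma> - 2"
    by simp_all
  note eqs = this
  show "K (\<beta> + \<alpha> - 1) = a powr (\<alpha> + \<beta> - 2) * mittag_leffler \<alpha> (\<alpha> - 1 + \<beta>) (m * a powr \<alpha>)"
    unfolding ml_kernel_def eqs(1) eqs(2) ..
  show "K (\<beta> + \<alpha>) = a powr (\<alpha> + \<beta> - 2) * a * mittag_leffler \<alpha> (\<alpha> + \<beta>) (m * a powr \<alpha>)"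
    unfolding ml_kernel_def eqs(3) using powr_pred[OF a(1), of "\<alpha> + \<beta> - 1"] unfolding eqs(4) by simp
  show "K (\<alpha> - \<gamma> - 1) = a powr (\<alpha> - \<gamma> - 2) * mittag_leffler \<alpha> (\<alpha> - 1 - \<gamma>) (m * a powr \<alpha>)"
    unfolding ml_kernel_def eqs(5) unfolding eqs(6) ..
  show "K (\<alpha> - \<gamma>) = a powr (\<alpha> - \<gamma> - 2) * a * mittag_leffler \<alpha> (\<alpha> - \<gamma>) (m * a powr \<alpha>)"
    unfolding ml_kernel_def using powr_pred[OF a(1), of "\<alpha> - \<gamma> - 1"] unfolding eqs(5) by simp
qed

private lemma D_eq: "D = a powr (\<alpha> - \<gamma> - 2) * a powr (\<alpha> + \<beta> - 2) * a * Delta m a \<alpha> \<beta> \<gamma>"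
proof -
  have "\<alpha> - 1 + \<beta> = \<alpha> + \<beta> - 1" by simp
  then show ?thesis
    unfolding D_def kernels_at_a Delta_def by (simp only: \<open>\<alpha> - 1 + \<beta> = \<alpha> + \<beta> - 1\<close>) (simp add: algebra_simps)
qed

private lemma D_nonzero: "D \<noteq> 0"
  using Delta a by (simp add: D_eq)

private lemma kernels_at_t:
  assumes "t > 0"
  shows "ml_kernel \<alpha> m \<alpha> t = t powr (\<alpha> - 2) * t * mittag_leffler \<alpha> \<alpha> (m * t powr \<alpha>)"
    "ml_kernel \<alpha> m (\<alpha> - 1) t = t powr (\<alpha> - 2) * mittag_leffler \<alpha> (\<alpha> - 1) (m * t powr \<alpha>)"
proof -
  have "\<alpha> - 1 - 1 = \<alpha> - 2" by simp
  then show "ml_kernel \<alpha> m \<alpha> t = t powr (\<alpha> - 2) * t * mittag_leffler \<alpha> \<alpha> (m * t powr \<alpha>)"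
    "ml_kernel \<alpha> m (\<alpha> - 1) t = t powr (\<alpha> - 2) * mittag_leffler \<alpha> (\<alpha> - 1) (m * t powr \<alpha>)"
    using powr_pred[OF assms, of "\<alpha> - 1"] by (simp_all add: ml_kernel_def)
qed

private lemma powr_at_a:
  "a powr (\<alpha> + \<beta> - 1) = a powr (\<alpha> + \<beta> - 2) * a" "a powr (\<alpha> - \<gamma> - 1) = a powr (\<alpha> - \<gamma> - 2) * a"
proof -
  have "\<alpha> + \<beta> - 1 - 1 = \<alpha> + \<beta> - 2" "\<alpha> - \<gamma> - 1 - 1 = \<alpha> - \<gamma> - 2" by simp_all
  then show "a powr (\<alpha> + \<beta> - 1) = a powr (\<alpha> + \<beta> - 2) * a"
    "a powr (\<alpha> - \<gamma> - 1) = a powr (\<alpha> - \<gamma> - 2) * a"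
    using powr_pred[OF a(1), of "\<alpha> + \<beta> - 1"] powr_pred[OF a(1), of "\<alpha> - \<gamma> - 1"] by simp_all
qed

text \<open>\<open>E1_hat\<close> and \<open>E2_hat\<close> are the solutions that Cramer's rule
  gives for the data (1,0) and (0,1).\<close>

private lemma E_hat_eq:
  assumes t: "t > 0"
  shows "E1_hat m a \<alpha> \<beta> \<gamma> t =
      (K (\<alpha> - \<gamma> - 1) * ml_kernel \<alpha> m \<alpha> t - K (\<alpha> - \<gamma>) * ml_kernel \<alpha> m (\<alpha> - 1) t) / D"
    and "E2_hat m a \<alpha> \<beta> \<gamma> t =
      (K (\<beta> + \<alpha>) * ml_kernel \<alpha> m (\<alpha> - 1) t - K (\<beta> + \<alpha> - 1) * ml_kernel \<alpha> m \<alpha> t) / D"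
proof -
  \<comment> \<open>The denominator of each of \<open>E1_hat\<close> and \<open>E2_hat\<close>
    contains only one of the two powers in \<open>D\<close>; the fraction is expanded by the
    other.\<close>
  have cancel: "P * x / (P * y) = x / y" if "P \<noteq> 0" for P x y :: real
    using that by simp
  let ?P = "a powr (\<alpha> - \<gamma> - 2)" and ?Q = "a powr (\<alpha> + \<beta> - 2)"
  have nz: "?P \<noteq> 0" "?Q \<noteq> 0" using a by auto
  show "E1_hat m a \<alpha> \<beta> \<gamma> t =
      (K (\<alpha> - \<gamma> - 1) * ml_kernel \<alpha> m \<alpha> t - K (\<alpha> - \<gamma>) * ml_kernel \<alpha> m (\<alpha> - 1) t) / D"
    unfolding E1_hat_def D_eq powr_at_a kernels_at_a kernels_at_t[OF t]
    using nz by (subst cancel[OF nz(1), symmetric]) (simp add: algebra_simps)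
  show "E2_hat m a \<alpha> \<beta> \<gamma> t =
      (K (\<beta> + \<alpha>) * ml_kernel \<alpha> m (\<alpha> - 1) t - K (\<beta> + \<alpha> - 1) * ml_kernel \<alpha> m \<alpha> t) / D"
    unfolding E2_hat_def D_eq powr_at_a kernels_at_a kernels_at_t[OF t]
    using nz by (subst cancel[OF nz(2), symmetric]) (simp add: algebra_simps)
qed

text \<open>Cramer's rule with real coefficients and unknowns in a real vector space, so that it
  serves complex and real solutions alike. The equivalence carries both existence and
  uniqueness.\<close>

private lemma linear_system:
  fixes c0 c1 X Y :: "'a::real_vector"
  shows "K (\<beta> + \<alpha> - 1) *\<^sub>R c0 + K (\<beta> + \<alpha>) *\<^sub>R c1 = X \<and> K (\<alpha> - \<gamma> - 1) *\<^sub>R c0 + K (\<alpha> - \<gamma>) *\<^sub>R c1 = Y \<longleftrightarrow>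
     c0 = (K (\<beta> + \<alpha>) / D) *\<^sub>R Y - (K (\<alpha> - \<gamma>) / D) *\<^sub>R X \<and>
     c1 = (K (\<alpha> - \<gamma> - 1) / D) *\<^sub>R X - (K (\<beta> + \<alpha> - 1) / D) *\<^sub>R Y"
proof -
  define p q r s where "p = K (\<beta> + \<alpha> - 1)" and "q = K (\<beta> + \<alpha>)" and "r = K (\<alpha> - \<gamma> - 1)" and "s = K (\<alpha> - \<gamma>)"
  have D: "D = q * r - p * s" by (simp add: D_def p_def q_def r_def s_def)
  have "c0 = (q / D) *\<^sub>R (r *\<^sub>R c0 + s *\<^sub>R c1) - (s / D) *\<^sub>R (p *\<^sub>R c0 + q *\<^sub>R c1)"
       "c1 = (r / D) *\<^sub>R (p *\<^sub>R c0 + q *\<^sub>R c1) - (p / D) *\<^sub>R (r *\<^sub>R c0 + s *\<^sub>R c1)"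
  proof -
    have "(q / D) *\<^sub>R (r *\<^sub>R c0 + s *\<^sub>R c1) - (s / D) *\<^sub>R (p *\<^sub>R c0 + q *\<^sub>R c1) = ((q * r - p * s) / D) *\<^sub>R c0"
      by (simp add: scaleR_add_right scaleR_diff_left diff_divide_distrib mult.commute)
    then show "c0 = (q / D) *\<^sub>R (r *\<^sub>R c0 + s *\<^sub>R c1) - (s / D) *\<^sub>R (p *\<^sub>R c0 + q *\<^sub>R c1)"
      using D_nonzero by (simp flip: D)
    have "(r / D) *\<^sub>R (p *\<^sub>R c0 + q *\<^sub>R c1) - (p / D) *\<^sub>R (r *\<^sub>R c0 + s *\<^sub>R c1) = ((q * r - p * s) / D) *\<^sub>R c1"
      by (simp add: scaleR_add_right scaleR_diff_left diff_divide_distrib mult.commute)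
    then show "c1 = (r / D) *\<^sub>R (p *\<^sub>R c0 + q *\<^sub>R c1) - (p / D) *\<^sub>R (r *\<^sub>R c0 + s *\<^sub>R c1)"
      using D_nonzero by (simp flip: D)
  qed
  moreover have "p *\<^sub>R ((q / D) *\<^sub>R Y - (s / D) *\<^sub>R X) + q *\<^sub>R ((r / D) *\<^sub>R X - (p / D) *\<^sub>R Y) = X"
    "r *\<^sub>R ((q / D) *\<^sub>R Y - (s / D) *\<^sub>R X) + s *\<^sub>R ((r / D) *\<^sub>R X - (p / D) *\<^sub>R Y) = Y"
  proof -
    have "p *\<^sub>R ((q / D) *\<^sub>R Y - (s / D) *\<^sub>R X) + q *\<^sub>R ((r / D) *\<^sub>R X - (p / D) *\<^sub>R Y) = ((q * r - p * s) / D) *\<^sub>R X"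
      by (simp add: scaleR_diff_right scaleR_diff_left diff_divide_distrib mult.commute)
    then show "p *\<^sub>R ((q / D) *\<^sub>R Y - (s / D) *\<^sub>R X) + q *\<^sub>R ((r / D) *\<^sub>R X - (p / D) *\<^sub>R Y) = X"
      using D_nonzero by (simp flip: D)
    have "r *\<^sub>R ((q / D) *\<^sub>R Y - (s / D) *\<^sub>R X) + s *\<^sub>R ((r / D) *\<^sub>R X - (p / D) *\<^sub>R Y) = ((q * r - p * s) / D) *\<^sub>R Y"
      by (simp add: scaleR_diff_right scaleR_diff_left diff_divide_distrib mult.commute)
    then show "r *\<^sub>R ((q / D) *\<^sub>R Y - (s / D) *\<^sub>R X) + s *\<^sub>R ((r / D) *\<^sub>R X - (p / D) *\<^sub>R Y) = Y"
      using D_nonzero by (simp flip: D)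
  qed
  ultimately show ?thesis
    unfolding p_def[symmetric] q_def[symmetric] r_def[symmetric] s_def[symmetric] by metis
qed

private lemma ml_solution_E_hat:
  fixes X Y :: "'a::{banach,second_countable_topology}"
  assumes "t > 0"
    and "c0 = (K (\<beta> + \<alpha>) / D) *\<^sub>R Y - (K (\<alpha> - \<gamma>) / D) *\<^sub>R X"
    and "c1 = (K (\<alpha> - \<gamma> - 1) / D) *\<^sub>R X - (K (\<beta> + \<alpha> - 1) / D) *\<^sub>R Y"
  shows "ml_solution \<alpha> m \<alpha> c0 c1 f t =
    E1_hat m a \<alpha> \<beta> \<gamma> t *\<^sub>R X + E2_hat m a \<alpha> \<beta> \<gamma> t *\<^sub>R Y + conv (ml_kernel \<alpha> m \<alpha>) f t"
  unfolding ml_solution_def E_hat_eq[OF assms(1)] assms(2,3)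
  by (simp add: scaleR_diff_right scaleR_diff_left diff_divide_distrib mult.commute)

text \<open>X and Y are the prescribed data minus what the particular solution contributes to the
  two conditions at a. Existence, formula and uniqueness for (A) and (B) are all instances of this
  equivalence.\<close>

lemma nonlocal_solution_iff:
  assumes f: "weighted_cont q T f" "q > -1"
    and X: "X = complex_of_real d1 - conv (ml_kernel \<alpha> m (\<alpha> + \<beta>)) f a"
    and Y: "Y = complex_of_real d2 - conv (ml_kernel \<alpha> m (\<alpha> - \<gamma>)) f a"
  shows "nonlocal_solution T m a \<alpha> \<beta> \<gamma> f d1 d2 u \<longleftrightarrow>
     (\<forall>t\<in>{0<..T}. u t = E1_hat m a \<alpha> \<beta> \<gamma> t *\<^sub>R X + E2_hat m a \<alpha> \<beta> \<gamma> t *\<^sub>R Y + conv (ml_kernel \<alpha> m \<alpha>) f t)"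
    (is "?N \<longleftrightarrow> ?E")
proof -
  define C0 where "C0 = (K (\<beta> + \<alpha>) / D) *\<^sub>R Y - (K (\<alpha> - \<gamma>) / D) *\<^sub>R X"
  define C1 where "C1 = (K (\<alpha> - \<gamma> - 1) / D) *\<^sub>R X - (K (\<beta> + \<alpha> - 1) / D) *\<^sub>R Y"
  have E: "?E \<longleftrightarrow> (\<forall>t\<in>{0<..T}. u t = ml_solution \<alpha> m \<alpha> C0 C1 f t)"
    using ml_solution_E_hat[OF _ C0_def C1_def, of _ f] by simp
  \<comment> \<open>Stated for arbitrary constants: one direction determines those of a given
    solution, the other checks the formula.\<close>
  have conditions: "rl_integral \<beta> u a = of_real d1 \<and> rl_deriv \<gamma> u a = of_real d2 \<longleftrightarrow> c0 = C0 \<and> c1 = C1"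
    if "\<And>t. t \<in> {0<..T} \<Longrightarrow> u t = ml_solution \<alpha> m \<alpha> c0 c1 f t" for c0 c1
  proof -
    have "rl_integral \<beta> u a = ml_solution \<alpha> m (\<beta> + \<alpha>) c0 c1 f a"
      using ml_solution_rl_derivs(1)[OF \<alpha> f that \<beta>, of a] a by simp
    moreover have "rl_deriv \<gamma> u a = ml_solution \<alpha> m (\<alpha> - \<gamma>) c0 c1 f a"
      using ml_solution_rl_derivs(5)[OF \<alpha> f that \<gamma>, of a] a by simp
    ultimately have "rl_integral \<beta> u a = of_real d1 \<and> rl_deriv \<gamma> u a = of_real d2 \<longleftrightarrow>
        K (\<beta> + \<alpha> - 1) *\<^sub>R c0 + K (\<beta> + \<alpha>) *\<^sub>R c1 = X \<and> K (\<alpha> - \<gamma> - 1) *\<^sub>R c0 + K (\<alpha> - \<gamma>) *\<^sub>R c1 = Y"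
      by (simp only: ml_solution_def X Y eq_diff_eq add.commute[of \<alpha> \<beta>])
    then show ?thesis
      unfolding linear_system C0_def C1_def .
  qed
  show ?thesis
  proof
    assume N: ?N
    then obtain p where p: "p > -1" "weighted_cont p T u"
      by (auto simp: nonlocal_solution_def C_minus_one_iff)
    from N have diff: "rl_differentiable_on \<alpha> u {0<..<T}"
      by (simp add: nonlocal_solution_def)
    have "rl_deriv \<alpha> u t = f t + m *\<^sub>R u t" if "t \<in> {0<..<T}" for t
      using N that by (simp add: nonlocal_solution_def scaleR_conv_of_real diff_eq_eq)
    from rl_solution_representation[OF \<alpha> p(2,1) f diff this]
    obtain c0 c1 where u: "u t = ml_solution \<alpha> m \<alpha> c0 c1 f t" if "t \<in> {0<..T}" for t
      by blast
    with conditions[OF u] N have "c0 = C0 \<and> c1 = C1"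
      by (simp add: nonlocal_solution_def)
    with u show ?E
      unfolding E by simp
  next
    assume ?E
    then have u: "u t = ml_solution \<alpha> m \<alpha> C0 C1 f t" if "t \<in> {0<..T}" for t
      using that unfolding E by blast
    have "weighted_cont (\<alpha> - 2) T u"
      using weighted_cont_ml_solution[OF _ \<alpha>(1) f, of \<alpha> m C0 C1] u \<alpha>
      by (subst weighted_cont_cong[where g = "ml_solution \<alpha> m \<alpha> C0 C1 f"]) auto
    then have "C_minus_one T u"
      using \<alpha> by (auto simp: C_minus_one_iff intro!: exI[of _ "\<alpha> - 2"])
    then show ?N
      using ml_solution_rl_derivs[OF \<alpha> f u] conditions[OF u] \<gamma>
      by (simp add: nonlocal_solution_def scaleR_conv_of_real)
  qed
qed

text \<open>\<open>nonlocal_solution\<close> speaks of complex functions, so the normalisation of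
  the real functions \<open>E1_hat\<close> and \<open>E2_hat\<close> is read off from the real
  instance of the solution family with f = 0.\<close>

lemma E_hat_rl_derivs:
  fixes X Y :: real
  assumes "\<And>t. t \<in> {0<..T} \<Longrightarrow> u t = E1_hat m a \<alpha> \<beta> \<gamma> t * X + E2_hat m a \<alpha> \<beta> \<gamma> t * Y"
  shows "rl_differentiable_on \<gamma> u {0<..<T}" "rl_integral \<beta> u a = X" "rl_deriv \<gamma> u a = Y"
proof -
  define C0 where "C0 = (K (\<beta> + \<alpha>) / D) *\<^sub>R Y - (K (\<alpha> - \<gamma>) / D) *\<^sub>R X"
  define C1 where "C1 = (K (\<alpha> - \<gamma> - 1) / D) *\<^sub>R X - (K (\<beta> + \<alpha> - 1) / D) *\<^sub>R Y"
  have [simp]: "conv k (\<lambda>_. 0 :: real) t = 0" for k t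
    by (simp add: conv_def)
  have u: "u t = ml_solution \<alpha> m \<alpha> C0 C1 (\<lambda>_. 0) t" if "t \<in> {0<..T}" for t
    using ml_solution_E_hat[OF _ C0_def C1_def, of t "\<lambda>_. 0"] assms[OF that] that by simp
  have 0: "weighted_cont 0 T (\<lambda>_. 0 :: real)" "0 > (-1::real)"
    by (auto intro: weighted_cont_zero)
  show "rl_differentiable_on \<gamma> u {0<..<T}"
    by (rule ml_solution_rl_derivs(4)[OF \<alpha> 0 u \<gamma>])
  have "K (\<beta> + \<alpha> - 1) *\<^sub>R C0 + K (\<beta> + \<alpha>) *\<^sub>R C1 = X \<and> K (\<alpha> - \<gamma> - 1) *\<^sub>R C0 + K (\<alpha> - \<gamma>) *\<^sub>R C1 = Y"
    unfolding linear_system by (simp add: C0_def C1_def)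
  moreover have "rl_integral \<beta> u a = ml_solution \<alpha> m (\<beta> + \<alpha>) C0 C1 (\<lambda>_. 0) a"
    by (rule ml_solution_rl_derivs(1)[OF \<alpha> 0 u \<beta>]) (use a in auto)
  moreover have "rl_deriv \<gamma> u a = ml_solution \<alpha> m (\<alpha> - \<gamma>) C0 C1 (\<lambda>_. 0) a"
    by (rule ml_solution_rl_derivs(5)[OF \<alpha> 0 u \<gamma>]) (use a in auto)
  ultimately show "rl_integral \<beta> u a = X" "rl_deriv \<gamma> u a = Y"
    by (simp_all add: ml_solution_def)
qed

lemma E_hat_regularity:
  assumes u: "\<And>t. t \<in> {0<..T} \<Longrightarrow> u t = E1_hat m a \<alpha> \<beta> \<gamma> t *\<^sub>R X + E2_hat m a \<alpha> \<beta> \<gamma> t *\<^sub>R Y +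
      conv (ml_kernel \<alpha> m \<alpha>) f t"
    and f: "if \<alpha> < 2 then C_minus_one_k 1 T f else C_minus_one T f"
  shows "C_minus_one_k 2 T (\<lambda>t. t powr (2 - \<alpha>) *\<^sub>R u t)"
proof -
  define C0 where "C0 = (K (\<beta> + \<alpha>) / D) *\<^sub>R Y - (K (\<alpha> - \<gamma>) / D) *\<^sub>R X"
  define C1 where "C1 = (K (\<alpha> - \<gamma> - 1) / D) *\<^sub>R X - (K (\<beta> + \<alpha> - 1) / D) *\<^sub>R Y"
  have u': "u t = ml_solution \<alpha> m \<alpha> C0 C1 f t" if "t \<in> {0<..T}" for t
    using ml_solution_E_hat[OF _ C0_def C1_def, of t f] u[OF that] that by simp
  show ?thesis
  proof (cases "\<alpha> < 2")
    case True
    then obtain q where q: "times_differentiable_on 1 f {0<..T}"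
        "weighted_cont q T (nth_vderiv {0<..T} 1 f)" "q > -1"
      using f by (auto simp: C_minus_one_k_def C_minus_one_iff)
    from C1_representation[OF this] obtain F0
      where "f t = F0 + conv (rl_kernel 1) (nth_vderiv {0<..T} 1 f) t" if "t \<in> {0<..T}" for t
      by blast
    from ml_solution_regularity[OF \<alpha>(1) q(2,3) this u'] show ?thesis .
  next
    case False
    then have "\<alpha> = 2" using \<alpha> by simp
    then obtain q where q: "weighted_cont q T f" "q > -1"
      using f by (auto simp: C_minus_one_iff)
    \<comment> \<open>The weight is now \<open>t powr 0\<close>, which is 1 for t > 0, and only such
      t matter here.\<close>
    show ?thesis
      by (rule ml_solution_regularity_2[OF q, of _ m C0 C1]) (use u' \<open>\<alpha> = 2\<close> in simp)
  qed
qed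

end

section \<open>Matching the formulas and conclusion\<close>

text \<open>The primitive of a derivative of exponent q has exponent q + 1 > 0, so f is a constant
  plus a function vanishing at 0 and exponent 0 works.\<close>

lemma C_minus_one_k_1_imp_C_minus_one:
  assumes "C_minus_one_k 1 T f"
  shows "C_minus_one T f"
proof -
  obtain q where q: "times_differentiable_on 1 f {0<..T}"
      "weighted_cont q T (nth_vderiv {0<..T} 1 f)" "q > -1"
    using assms by (auto simp: C_minus_one_k_def C_minus_one_iff)
  from C1_representation[OF this] obtain F0
    where f: "f t = F0 + conv (rl_kernel 1) (nth_vderiv {0<..T} 1 f) t" if "t \<in> {0<..T}" for t
    by blast
  let ?h = "\<lambda>t. F0 + conv (rl_kernel 1) (nth_vderiv {0<..T} 1 f) t"
  have "weighted_cont (q + 1) T (conv (rl_kernel 1) (nth_vderiv {0<..T} 1 f))"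
    using weighted_cont_conv[OF weighted_cont_rl_kernel[of 1] q(2)] q(3) by simp
  then have "weighted_cont 0 T ?h"
    using q(3) by (intro weighted_cont_add weighted_cont_const) (auto intro: weighted_cont_mono)
  then have "weighted_cont 0 T f"
    using f by (subst weighted_cont_cong[where g = ?h]) auto
  then show ?thesis
    by (auto simp: C_minus_one_iff intro!: exI[of _ 0])
qed

text \<open>The first integral splits into convolutions at a with the kernels of index \<alpha> +
  \<beta> and \<alpha> - \<gamma>. Their negatives are X and Y of
  \<open>nonlocal_solution_iff\<close> for zero data.\<close>

lemma u_f_eq:
  assumes f: "weighted_cont q T f" "q > -1" and a: "0 < a" "a \<le> T" and "\<alpha> > 1" "\<beta> \<ge> 0" "\<gamma> < \<alpha>"
  shows "u_f m a \<alpha> \<beta> \<gamma> f t =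
     E1_hat m a \<alpha> \<beta> \<gamma> t *\<^sub>R (- conv (ml_kernel \<alpha> m (\<alpha> + \<beta>)) f a) +
     E2_hat m a \<alpha> \<beta> \<gamma> t *\<^sub>R (- conv (ml_kernel \<alpha> m (\<alpha> - \<gamma>)) f a) + conv (ml_kernel \<alpha> m \<alpha>) f t"
proof -
  let ?E1 = "E1_hat m a \<alpha> \<beta> \<gamma> t" and ?E2 = "E2_hat m a \<alpha> \<beta> \<gamma> t"
  have "(LBINT s:{0..a}. (s powr (\<alpha> - 1) *
             (s powr \<beta> * mittag_leffler \<alpha> (\<alpha> + \<beta>) (m * s powr \<alpha>) * ?E1
              + s powr (-\<gamma>) * mittag_leffler \<alpha> (\<alpha> - \<gamma>) (m * s powr \<alpha>) * ?E2)) *\<^sub>R f (a - s)) =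
     (LBINT s:{0<..<a}. (?E1 * ml_kernel \<alpha> m (\<alpha> + \<beta>) s + ?E2 * ml_kernel \<alpha> m (\<alpha> - \<gamma>) s) *\<^sub>R f (a - s))"
    unfolding lborel_set_integral_Icc_eq_Ioo
  proof (rule set_lebesgue_integral_cong, simp, intro allI impI)
    fix s assume "s \<in> {0<..<a}"
    have "s powr (\<alpha> + \<beta> - 1) = s powr (\<alpha> - 1) * s powr \<beta>" "s powr (\<alpha> - \<gamma> - 1) = s powr (\<alpha> - 1) * s powr (- \<gamma>)"
      unfolding powr_add[symmetric] by (rule arg_cong[where f = "(powr) s"], simp)+
    then show "(s powr (\<alpha> - 1) *
             (s powr \<beta> * mittag_leffler \<alpha> (\<alpha> + \<beta>) (m * s powr \<alpha>) * ?E1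
              + s powr (-\<gamma>) * mittag_leffler \<alpha> (\<alpha> - \<gamma>) (m * s powr \<alpha>) * ?E2)) *\<^sub>R f (a - s) =
       (?E1 * ml_kernel \<alpha> m (\<alpha> + \<beta>) s + ?E2 * ml_kernel \<alpha> m (\<alpha> - \<gamma>) s) *\<^sub>R f (a - s)"
      unfolding ml_kernel_def by (simp only: distrib_left mult_ac)
  qed
  also have "\<dots> = conv (\<lambda>s. ?E1 * ml_kernel \<alpha> m (\<alpha> + \<beta>) s + ?E2 * ml_kernel \<alpha> m (\<alpha> - \<gamma>) s) f a"
    by (rule conv_commute[symmetric])
  also have "\<dots> = conv (\<lambda>s. ?E1 * ml_kernel \<alpha> m (\<alpha> + \<beta>) s) f a + conv (\<lambda>s. ?E2 * ml_kernel \<alpha> m (\<alpha> - \<gamma>) s) f a"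
    by (rule conv_add_left[OF weighted_cont_scaleR[OF weighted_cont_ml_kernel, unfolded real_scaleR_def]
          weighted_cont_scaleR[OF weighted_cont_ml_kernel, unfolded real_scaleR_def] f(1)])
       (use assms in auto)
  finally show ?thesis
    unfolding u_f_def
    by (simp add: conv_mult_left lborel_set_integral_Icc_eq_Ioo
          conv_commute[of "ml_kernel \<alpha> m \<alpha>" f t] ml_kernel_def[of _ _ \<alpha>])
qed

theorem theorem3p1:
  fixes T m a \<alpha> \<beta> \<gamma> :: real
  assumes "T > 0" and "0 < a" "a < T"
    and "1 < \<alpha>" "\<alpha> \<le> 2"
    and "0 \<le> \<beta>" "\<beta> \<le> 2 - \<alpha>"
    and "0 < \<gamma>" "\<gamma> \<le> \<alpha> - 1"
    and "mittag_leffler \<alpha> (\<alpha> + \<beta>) (m * a powr \<alpha>) * mittag_leffler \<alpha> (\<alpha> - 1 - \<gamma>) (m * a powr \<alpha>)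
         \<noteq> mittag_leffler \<alpha> (\<alpha> + \<beta> - 1) (m * a powr \<alpha>) * mittag_leffler \<alpha> (\<alpha> - \<gamma>) (m * a powr \<alpha>)"
  shows
    "(\<forall>f :: real \<Rightarrow> complex.
        (if \<alpha> < 2 then C_minus_one_k 1 T f else C_minus_one T f) \<longrightarrow>
          nonlocal_solution T m a \<alpha> \<beta> \<gamma> f 0 0 (u_f m a \<alpha> \<beta> \<gamma> f) \<and>
          C_minus_one_k 2 T (\<lambda>t. t powr (2 - \<alpha>) *\<^sub>R u_f m a \<alpha> \<beta> \<gamma> f t) \<and>
          (\<forall>u. nonlocal_solution T m a \<alpha> \<beta> \<gamma> f 0 0 u \<longrightarrow>
             (\<forall>t\<in>{0<..T}. u t = u_f m a \<alpha> \<beta> \<gamma> f t))) \<and>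
     (\<forall>d1 d2 :: real.
        nonlocal_solution T m a \<alpha> \<beta> \<gamma> (\<lambda>t. 0) d1 d2 (u_0 m a \<alpha> \<beta> \<gamma> d1 d2) \<and>
        (\<forall>u. nonlocal_solution T m a \<alpha> \<beta> \<gamma> (\<lambda>t. 0) d1 d2 u \<longrightarrow>
           (\<forall>t\<in>{0<..T}. u t = u_0 m a \<alpha> \<beta> \<gamma> d1 d2 t))) \<and>
     rl_differentiable_on \<gamma> (E1_hat m a \<alpha> \<beta> \<gamma>) {0<..<T} \<and>
     rl_differentiable_on \<gamma> (E2_hat m a \<alpha> \<beta> \<gamma>) {0<..<T} \<and>
     rl_integral \<beta> (E1_hat m a \<alpha> \<beta> \<gamma>) a = 1 \<and>
     rl_deriv \<gamma> (E1_hat m a \<alpha> \<beta> \<gamma>) a = 0 \<and>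
     rl_integral \<beta> (E2_hat m a \<alpha> \<beta> \<gamma>) a = 0 \<and>
     rl_deriv \<gamma> (E2_hat m a \<alpha> \<beta> \<gamma>) a = 1"
proof -
  have \<Delta>: "Delta m a \<alpha> \<beta> \<gamma> \<noteq> 0"
    using assms(10) by (simp add: Delta_def)
  note hyps = assms(2,3,4,5,6,8,9) \<Delta>
  have A: "nonlocal_solution T m a \<alpha> \<beta> \<gamma> f 0 0 (u_f m a \<alpha> \<beta> \<gamma> f) \<and>
      C_minus_one_k 2 T (\<lambda>t. t powr (2 - \<alpha>) *\<^sub>R u_f m a \<alpha> \<beta> \<gamma> f t) \<and>
      (\<forall>u. nonlocal_solution T m a \<alpha> \<beta> \<gamma> f 0 0 u \<longrightarrow> (\<forall>t\<in>{0<..T}. u t = u_f m a \<alpha> \<beta> \<gamma> f t))"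
    if C: "if \<alpha> < 2 then C_minus_one_k 1 T f else C_minus_one T f" for f :: "real \<Rightarrow> complex"
  proof -
    have "C_minus_one T f"
      using C by (auto split: if_splits intro: C_minus_one_k_1_imp_C_minus_one)
    then obtain q where f: "weighted_cont q T f" "q > -1"
      by (auto simp: C_minus_one_iff)
    note u_f = u_f_eq[OF f, of a \<alpha> \<beta> \<gamma> m]
    have iff: "nonlocal_solution T m a \<alpha> \<beta> \<gamma> f 0 0 u \<longleftrightarrow> (\<forall>t\<in>{0<..T}. u t = u_f m a \<alpha> \<beta> \<gamma> f t)" for u
      using nonlocal_solution_iff[OF hyps f refl refl, of 0 0 u] u_f assms by simp
    show ?thesis
      using E_hat_regularity[OF hyps u_f C] iff assms by simp
  qed
  \<comment> \<open>With f = 0 the convolutions vanish, so X and Y are the data themselves.\<close>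
  have B: "nonlocal_solution T m a \<alpha> \<beta> \<gamma> (\<lambda>t. 0) d1 d2 u \<longleftrightarrow>
      (\<forall>t\<in>{0<..T}. u t = u_0 m a \<alpha> \<beta> \<gamma> d1 d2 t)" for d1 d2 :: real and u
  proof -
    have [simp]: "conv k (\<lambda>_. 0 :: complex) t = 0" for k t
      by (simp add: conv_def)
    show ?thesis
      using nonlocal_solution_iff[OF hyps weighted_cont_zero[of 0] _ refl refl, of d1 d2 u]
      by (simp add: u_0_def scaleR_conv_of_real mult.commute)
  qed
  have E1: "rl_differentiable_on \<gamma> (E1_hat m a \<alpha> \<beta> \<gamma>) {0<..<T}"
      "rl_integral \<beta> (E1_hat m a \<alpha> \<beta> \<gamma>) a = 1" "rl_deriv \<gamma> (E1_hat m a \<alpha> \<beta> \<gamma>) a = 0"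
    by (rule E_hat_rl_derivs[OF hyps, of _ 1 0]; simp)+
  have E2: "rl_differentiable_on \<gamma> (E2_hat m a \<alpha> \<beta> \<gamma>) {0<..<T}"
      "rl_integral \<beta> (E2_hat m a \<alpha> \<beta> \<gamma>) a = 0" "rl_deriv \<gamma> (E2_hat m a \<alpha> \<beta> \<gamma>) a = 1"
    by (rule E_hat_rl_derivs[OF hyps, of _ 0 1]; simp)+
  show ?thesis
    using A B E1 E2 by blast
qed

end
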